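(* (i) A finite sequence $\lambda=\{\tilde\alpha^l,\ldots,\tilde\alpha^1\}$ of pairwise distinct roots from $\tilde R_+$ can be represented in the form $\lambda(\hat w)$ (as a sequence, for some reduced decomposition of some $\hat w\in\hat W$) if and only if the following six conditions are satisfied: (a) if $\tilde\alpha=\tilde\alpha^q+\tilde\alpha^r\notin[0,\mathbb Z]$ and $\tilde\alpha\in\tilde R_+$, then $\tilde\alpha\in\lambda$; (b) if $\tilde\alpha^p=\tilde\alpha^q+\tilde\alpha^r$, then $p$ is between $q$ and $r$; (c) if $\tilde\alpha^p=\tilde\beta+\tilde\gamma$ for $\tilde\beta,\tilde\gamma\in\tilde R_+$, then $\tilde\beta\in\lambda$ or $\tilde\gamma\in\lambda$; (d) if $\tilde\alpha^p=\tilde\alpha^q+\tilde\gamma$ for some $\tilde\gamma\in\tilde R_+$, $\tilde\gamma\notin\lambda$, then $q<p$; (e) if $\tilde\alpha^p=[\alpha,\nu_\alpha j]\in\lambda$, $[\alpha,\nu_\alpha j']\in\tilde R_+$ and $0\le j'<j$, then $[\alpha,\nu_\alpha j']\in\lambda$; (f) if $\tilde\alpha^p=[\alpha,\nu_\alpha j]$, $\tilde\alpha^q=[\alpha,\nu_\alpha j']$ and $0\le j'<j$, then $q<p$. (ii) If (a), (c), (e) hold for a finite set $\lambda\subset\tilde R_+$, then there exists at least one ordering of $\lambda$ satisfying (b), (d), (f). All such sequences are in one-to-one correspondence with the reduced decompositions of the element $\tilde w\in\tilde W$ such that $\lambda(\tilde w)=\lambda$. (iii) Conditions (a), (b), (c),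 (d) imply the following conditions, where $u,v$ are arbitrary positive rational numbers: (a') if $\tilde\alpha'=u\tilde\alpha^q+v\tilde\alpha^r\in\tilde R_+$, then $\tilde\alpha'\in\lambda$; (b') if $\tilde\alpha^p=u\tilde\alpha^q+v\tilde\alpha^r$, then $p$ is between $q$ and $r$; (c') if $\tilde\alpha^p=u\tilde\beta+v\tilde\gamma$ for $\tilde\beta,\tilde\gamma\in\tilde R_+$, then $\tilde\beta\in\lambda$ or $\tilde\gamma\in\lambda$; (d') if $\tilde\alpha^p=u\tilde\alpha^q+v\tilde\gamma$ for some $\tilde\gamma\in\tilde R_+$, $\tilde\gamma\notin\lambda$, then $q<p$. These conditions coincide with (a), (b), (c), (d) in the simply-laced case.
   Context: Let $R\subset\mathbb R^n$ be an irreducible reduced root system (type $A,\ldots,G$) with Weyl group $W$, simple roots $\alpha_1,\dots,\alpha_n$, positive roots $R_+$, and the $W$-invariant form $(\,,\,)$ normalized by $(\alpha,\alpha)=2$ for short roots; $\nu_\alpha=(\alpha,\alpha)/2$, $\alpha^\vee=2\alpha/(\alpha,\alpha)$; $Q\subset P$ are the root and weight lattices. Let $\vartheta$ be the maximal short root. The affine root system is $\tilde R=\{[\alpha,\nu_\alpha j]:\alpha\in R,\ j\in\mathbb Z\}\subset\mathbb R^n\times\mathbb R$ ($\alpha$ is identified with $[\alpha,0]$), $\alpha_0=[-\vartheta,1]$, $\tilde R_+=R_+\cup\{[\alpha,\nu_\alpha j]: j>0\}$, $\tilde R_-=-\tilde R_+$. For $\tilde z=[z,\zeta]$, $s_{\tilde\alpha}(\tilde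 z)=\tilde z-(z,\alpha^\vee)\tilde\alpha$ and $b(\tilde z)=[z,\zeta-(z,b)]$ for $b\in P$. $\tilde W$ is generated by $s_i=s_{\alpha_i}$, $0\le i\le n$; $\hat W=W\ltimes P=\Pi\ltimes\tilde W$, where $\Pi=\{\pi_r\}$ is the subgroup preserving $\{\alpha_0,\dots,\alpha_n\}$. The length of $\pi_r\tilde w$ is the length of $\tilde w$. $\lambda(\hat w)=\tilde R_+\cap\hat w^{-1}(\tilde R_-)$. Given a reduced decomposition $\hat w=\pi_rs_{i_l}\cdots s_{i_1}$, this set is ordered: $\lambda(\hat w)=\{\tilde\alpha^l,\ldots,\tilde\alpha^1\}$ with $\tilde\alpha^p=s_{i_1}\cdots s_{i_{p-1}}(\alpha_{i_p})$; this is the sequence $\lambda(\hat w)$. In the conditions, $p,q,r$ are the indices (positions) of the elements of $\lambda$.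
   Formalization: The "if" part of (i), the existence of w̃ in (ii), and (iii) are stated for rank at least 2 only, since they fail in type A_1 (λ={[α,0],[-α,1]}); (b') requires q≠r; "coincide" in the simply-laced case means that the system (a')-(d') is equivalent to (a)-(d). *)

theory Defs
  imports "HOL-Analysis.Analysis"
begin

section \<open>Finite root systems\<close>

text \<open>The ambient space \<open>\<real>\<^sup>n\<close> is a Euclidean space \<open>'a\<close> with \<open>n = DIM('a)\<close>; its inner product is
  the \<open>W\<close>-invariant form \<open>( , )\<close>, normalized by the predicate \<open>normalized_form\<close> below.\<close>

definition coroot :: "'a::euclidean_space \<Rightarrow> 'a" where
  "coroot \<alpha> = (2 / (\<alpha> \<bullet> \<alpha>)) *\<^sub>R \<alpha>"

definition reduced_root_system :: "'a::euclidean_space set \<Rightarrow> bool" where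
  "reduced_root_system R \<longleftrightarrow>
     finite R \<and> span R = UNIV \<and> 0 \<notin> R \<and>
     (\<forall>\<alpha>\<in>R. \<forall>\<beta>\<in>R. \<beta> - (\<beta> \<bullet> coroot \<alpha>) *\<^sub>R \<alpha> \<in> R) \<and>
     (\<forall>\<alpha>\<in>R. \<forall>\<beta>\<in>R. \<beta> \<bullet> coroot \<alpha> \<in> \<int>) \<and>
     (\<forall>\<alpha>\<in>R. \<forall>c. c *\<^sub>R \<alpha> \<in> R \<longrightarrow> c = 1 \<or> c = -1)"

definition irreducible_roots :: "'a::euclidean_space set \<Rightarrow> bool" where
  "irreducible_roots R \<longleftrightarrow>
     R \<noteq> {} \<and>
     \<not> (\<exists>S. S \<subseteq> R \<and> S \<noteq> {} \<and> S \<noteq> R \<and> (\<forall>\<alpha>\<in>S. \<forall>\<beta>\<in>R - S. \<alpha> \<bullet> \<beta> = 0))"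

definition short_root :: "'a::euclidean_space set \<Rightarrow> 'a \<Rightarrow> bool" where
  "short_root R \<alpha> \<longleftrightarrow> \<alpha> \<in> R \<and> (\<forall>\<beta>\<in>R. \<alpha> \<bullet> \<alpha> \<le> \<beta> \<bullet> \<beta>)"

definition normalized_form :: "'a::euclidean_space set \<Rightarrow> bool" where
  "normalized_form R \<longleftrightarrow> (\<forall>\<alpha>. short_root R \<alpha> \<longrightarrow> \<alpha> \<bullet> \<alpha> = 2)"

text \<open>If all roots have the same length, all of them count as short, so that \<open>\<nu> = 1\<close>.\<close>

definition simply_laced :: "'a::euclidean_space set \<Rightarrow> bool" where
  "simply_laced R \<longleftrightarrow> (\<forall>\<alpha>\<in>R. \<forall>\<beta>\<in>R. \<alpha> \<bullet> \<alpha> = \<beta> \<bullet> \<beta>)"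

text \<open>Simple roots are given as \<open>a 1, \<dots>, a n\<close>; the values of \<open>a\<close> at other indices are irrelevant.\<close>

definition nonneg_comb :: "(nat \<Rightarrow> 'a::euclidean_space) \<Rightarrow> 'a set" where
  "nonneg_comb a = {\<Sum>i\<in>{1..DIM('a)}. real (c i) *\<^sub>R a i | c :: nat \<Rightarrow> nat. True}"

definition simple_roots :: "'a::euclidean_space set \<Rightarrow> (nat \<Rightarrow> 'a) \<Rightarrow> bool" where
  "simple_roots R a \<longleftrightarrow>
     a ` {1..DIM('a)} \<subseteq> R \<and> inj_on a {1..DIM('a)} \<and> independent (a ` {1..DIM('a)}) \<and>
     (\<forall>\<beta>\<in>R. \<beta> \<in> nonneg_comb a \<or> - \<beta> \<in> nonneg_comb a)"

definition positive_roots :: "'a::euclidean_space set \<Rightarrow> (nat \<Rightarrow> 'a) \<Rightarrow> 'a set" where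
  "positive_roots R a = R \<inter> nonneg_comb a"

text \<open>Maximality is with respect to the order \<open>\<beta> \<le> \<gamma> \<longleftrightarrow> \<gamma> - \<beta> \<in> nonneg_comb a\<close>.\<close>

definition maximal_short_root :: "'a::euclidean_space set \<Rightarrow> (nat \<Rightarrow> 'a) \<Rightarrow> 'a \<Rightarrow> bool" where
  "maximal_short_root R a \<theta> \<longleftrightarrow>
     short_root R \<theta> \<and> (\<forall>\<beta>. short_root R \<beta> \<and> \<beta> - \<theta> \<in> nonneg_comb a \<longrightarrow> \<beta> = \<theta>)"

definition weight_lattice :: "'a::euclidean_space set \<Rightarrow> 'a set" where
  "weight_lattice R = {b. \<forall>\<alpha>\<in>R. b \<bullet> coroot \<alpha> \<in> \<int>}"


section \<open>Affine roots and the extended affine Weyl group\<close>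

text \<open>The pair \<open>(z, \<zeta>) :: 'a \<times> real\<close> is the vector \<open>[z, \<zeta>]\<close>.\<close>

definition \<nu> :: "'a::euclidean_space \<Rightarrow> real" where
  "\<nu> \<alpha> = (\<alpha> \<bullet> \<alpha>) / 2"

definition affine_root :: "'a::euclidean_space \<Rightarrow> int \<Rightarrow> 'a \<times> real" where
  "affine_root \<alpha> j = (\<alpha>, \<nu> \<alpha> * of_int j)"

definition affine_roots :: "'a::euclidean_space set \<Rightarrow> ('a \<times> real) set" where
  "affine_roots R = {affine_root \<alpha> j | \<alpha> j. \<alpha> \<in> R}"

definition affine_pos :: "'a::euclidean_space set \<Rightarrow> (nat \<Rightarrow> 'a) \<Rightarrow> ('a \<times> real) set" where
  "affine_pos R a =
     {affine_root \<alpha> 0 | \<alpha>. \<alpha> \<in> positive_roots R a} \<union> {affine_root \<alpha> j | \<alpha> j. \<alpha> \<in> R \<and> j > 0}"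

definition affine_neg :: "'a::euclidean_space set \<Rightarrow> (nat \<Rightarrow> 'a) \<Rightarrow> ('a \<times> real) set" where
  "affine_neg R a = uminus ` affine_pos R a"

definition affine_simple :: "(nat \<Rightarrow> 'a::euclidean_space) \<Rightarrow> 'a \<Rightarrow> nat \<Rightarrow> 'a \<times> real" where
  "affine_simple a \<theta> i = (if i = 0 then (- \<theta>, 1) else (a i, 0))"

definition affine_refl :: "'a::euclidean_space \<times> real \<Rightarrow> 'a \<times> real \<Rightarrow> 'a \<times> real" where
  "affine_refl \<beta> z = z - (fst z \<bullet> coroot (fst \<beta>)) *\<^sub>R \<beta>"

definition translation :: "'a::euclidean_space \<Rightarrow> 'a \<times> real \<Rightarrow> 'a \<times> real" where
  "translation b z = (fst z, snd z - fst z \<bullet> b)"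

abbreviation simple_refl ::
    "(nat \<Rightarrow> 'a::euclidean_space) \<Rightarrow> 'a \<Rightarrow> nat \<Rightarrow> 'a \<times> real \<Rightarrow> 'a \<times> real" where
  "simple_refl a \<theta> i \<equiv> affine_refl (affine_simple a \<theta> i)"

text \<open>All groups are groups of transformations of \<open>'a \<times> real\<close>. The set \<open>generated S\<close> is the monoid
  generated by \<open>S\<close>; it is only used for sets \<open>S\<close> of involutions, where it is the generated group.\<close>

inductive_set generated :: "('b \<Rightarrow> 'b) set \<Rightarrow> ('b \<Rightarrow> 'b) set" for S :: "('b \<Rightarrow> 'b) set" where
  id: "id \<in> generated S"
| comp: "s \<in> S \<Longrightarrow> w \<in> generated S \<Longrightarrow> s \<circ> w \<in> generated S"

definition weyl_group :: "'a::euclidean_space set \<Rightarrow> ('a \<times> real \<Rightarrow> 'a \<times> real) set" where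
  "weyl_group R = generated {affine_refl (\<alpha>, 0) | \<alpha>. \<alpha> \<in> R}"

definition extended_weyl_group :: "'a::euclidean_space set \<Rightarrow> ('a \<times> real \<Rightarrow> 'a \<times> real) set" where
  "extended_weyl_group R = {w \<circ> translation b | w b. w \<in> weyl_group R \<and> b \<in> weight_lattice R}"

definition affine_weyl_group ::
    "(nat \<Rightarrow> 'a::euclidean_space) \<Rightarrow> 'a \<Rightarrow> ('a \<times> real \<Rightarrow> 'a \<times> real) set" where
  "affine_weyl_group a \<theta> = generated (simple_refl a \<theta> ` {0..DIM('a)})"

definition Pi_group ::
    "'a::euclidean_space set \<Rightarrow> (nat \<Rightarrow> 'a) \<Rightarrow> 'a \<Rightarrow> ('a \<times> real \<Rightarrow> 'a \<times> real) set" where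
  "Pi_group R a \<theta> =
     {g \<in> extended_weyl_group R.
        g ` (affine_simple a \<theta> ` {0..DIM('a)}) = affine_simple a \<theta> ` {0..DIM('a)}}"


section \<open>Reduced decompositions and the sets and sequences \<open>\<lambda>(w)\<close>\<close>

text \<open>A word \<open>[i\<^sub>1, \<dots>, i\<^sub>l]\<close> stands for the product \<open>s\<^bsub>i\<^sub>l\<^esub> \<cdots> s\<^bsub>i\<^sub>1\<^esub>\<close>, in this order.\<close>

primrec word_prod ::
    "(nat \<Rightarrow> 'a::euclidean_space) \<Rightarrow> 'a \<Rightarrow> nat list \<Rightarrow> 'a \<times> real \<Rightarrow> 'a \<times> real" where
  "word_prod a \<theta> [] = id"
| "word_prod a \<theta> (i # is) = word_prod a \<theta> is \<circ> simple_refl a \<theta> i"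

definition affine_length ::
    "(nat \<Rightarrow> 'a::euclidean_space) \<Rightarrow> 'a \<Rightarrow> ('a \<times> real \<Rightarrow> 'a \<times> real) \<Rightarrow> nat" where
  "affine_length a \<theta> w =
     (LEAST l. \<exists>is. set is \<subseteq> {0..DIM('a)} \<and> length is = l \<and> word_prod a \<theta> is = w)"

definition reduced_words ::
    "(nat \<Rightarrow> 'a::euclidean_space) \<Rightarrow> 'a \<Rightarrow> ('a \<times> real \<Rightarrow> 'a \<times> real) \<Rightarrow> nat list set" where
  "reduced_words a \<theta> w =
     {is. set is \<subseteq> {0..DIM('a)} \<and> word_prod a \<theta> is = w \<and> length is = affine_length a \<theta> w}"

definition reduced_decomposition ::
    "'a::euclidean_space set \<Rightarrow> (nat \<Rightarrow> 'a) \<Rightarrow> 'a \<Rightarrow>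
     ('a \<times> real \<Rightarrow> 'a \<times> real) \<Rightarrow> ('a \<times> real \<Rightarrow> 'a \<times> real) \<Rightarrow> nat list \<Rightarrow> bool" where
  "reduced_decomposition R a \<theta> w g is \<longleftrightarrow>
     g \<in> Pi_group R a \<theta> \<and> w = g \<circ> word_prod a \<theta> is \<and>
     is \<in> reduced_words a \<theta> (word_prod a \<theta> is)"

definition lambda_set ::
    "'a::euclidean_space set \<Rightarrow> (nat \<Rightarrow> 'a) \<Rightarrow> ('a \<times> real \<Rightarrow> 'a \<times> real) \<Rightarrow> ('a \<times> real) set" where
  "lambda_set R a w = affine_pos R a \<inter> w -` affine_neg R a"

text \<open>Sequences \<open>{\<alpha>\<^sup>l, \<dots>, \<alpha>\<^sup>1}\<close> of affine roots are listed by increasing position, that is, as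
  \<open>[\<alpha>\<^sup>1, \<dots>, \<alpha>\<^sup>l]\<close>; since list positions start from 0, the root \<open>\<alpha>\<^sup>p\<close> is at position \<open>p - 1\<close>.
  This shift does not affect any comparison of positions.\<close>

definition lambda_seq ::
    "(nat \<Rightarrow> 'a::euclidean_space) \<Rightarrow> 'a \<Rightarrow> nat list \<Rightarrow> ('a \<times> real) list" where
  "lambda_seq a \<theta> is =
     map (\<lambda>p. foldr (simple_refl a \<theta>) (take p is) (affine_simple a \<theta> (is ! p))) [0..<length is]"

definition is_lambda_sequence ::
    "'a::euclidean_space set \<Rightarrow> (nat \<Rightarrow> 'a) \<Rightarrow> 'a \<Rightarrow> ('a \<times> real) list \<Rightarrow> bool" where
  "is_lambda_sequence R a \<theta> xs \<longleftrightarrow>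
     (\<exists>w\<in>extended_weyl_group R. \<exists>g is.
        reduced_decomposition R a \<theta> w g is \<and> xs = lambda_seq a \<theta> is \<and> set xs = lambda_set R a w)"

definition positive_seq ::
    "'a::euclidean_space set \<Rightarrow> (nat \<Rightarrow> 'a) \<Rightarrow> ('a \<times> real) list \<Rightarrow> bool" where
  "positive_seq R a xs \<longleftrightarrow> distinct xs \<and> set xs \<subseteq> affine_pos R a"


section \<open>The conditions\<close>

text \<open>Rank one is exceptional: for \<open>R = {\<alpha>, - \<alpha>}\<close>, a sum of two affine roots is never an affine root,
  and \<open>[[\<alpha>, 0], [- \<alpha>, 1]]\<close> satisfies all of the conditions a--f (and violates a'), although it is
  not of the form \<open>\<lambda>(w)\<close>.\<close>

definition between :: "nat \<Rightarrow> nat \<Rightarrow> nat \<Rightarrow> bool" where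
  "between p q r \<longleftrightarrow> q < p \<and> p < r \<or> r < p \<and> p < q"

definition cond_a :: "'a::euclidean_space set \<Rightarrow> (nat \<Rightarrow> 'a) \<Rightarrow> ('a \<times> real) set \<Rightarrow> bool" where
  "cond_a R a L \<longleftrightarrow>
     (\<forall>x\<in>L. \<forall>y\<in>L. x + y \<notin> {0} \<times> \<int> \<and> x + y \<in> affine_pos R a \<longrightarrow> x + y \<in> L)"

definition cond_b :: "('a::euclidean_space \<times> real) list \<Rightarrow> bool" where
  "cond_b xs \<longleftrightarrow>
     (\<forall>p<length xs. \<forall>q<length xs. \<forall>r<length xs. xs ! p = xs ! q + xs ! r \<longrightarrow> between p q r)"

definition cond_c :: "'a::euclidean_space set \<Rightarrow> (nat \<Rightarrow> 'a) \<Rightarrow> ('a \<times> real) set \<Rightarrow> bool" where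
  "cond_c R a L \<longleftrightarrow>
     (\<forall>x\<in>L. \<forall>\<beta>\<in>affine_pos R a. \<forall>\<gamma>\<in>affine_pos R a. x = \<beta> + \<gamma> \<longrightarrow> \<beta> \<in> L \<or> \<gamma> \<in> L)"

definition cond_d :: "'a::euclidean_space set \<Rightarrow> (nat \<Rightarrow> 'a) \<Rightarrow> ('a \<times> real) list \<Rightarrow> bool" where
  "cond_d R a xs \<longleftrightarrow>
     (\<forall>p<length xs. \<forall>q<length xs. \<forall>\<gamma>\<in>affine_pos R a.
        \<gamma> \<notin> set xs \<and> xs ! p = xs ! q + \<gamma> \<longrightarrow> q < p)"

definition cond_e :: "'a::euclidean_space set \<Rightarrow> (nat \<Rightarrow> 'a) \<Rightarrow> ('a \<times> real) set \<Rightarrow> bool" where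
  "cond_e R a L \<longleftrightarrow>
     (\<forall>\<alpha> j j'. affine_root \<alpha> j \<in> L \<and> affine_root \<alpha> j' \<in> affine_pos R a \<and> 0 \<le> j' \<and> j' < j
        \<longrightarrow> affine_root \<alpha> j' \<in> L)"

definition cond_f :: "('a::euclidean_space \<times> real) list \<Rightarrow> bool" where
  "cond_f xs \<longleftrightarrow>
     (\<forall>p<length xs. \<forall>q<length xs. \<forall>\<alpha> j j'.
        xs ! p = affine_root \<alpha> j \<and> xs ! q = affine_root \<alpha> j' \<and> 0 \<le> j' \<and> j' < j \<longrightarrow> q < p)"

definition cond_a' :: "'a::euclidean_space set \<Rightarrow> (nat \<Rightarrow> 'a) \<Rightarrow> ('a \<times> real) set \<Rightarrow> bool" where
  "cond_a' R a L \<longleftrightarrow>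
     (\<forall>u v :: rat. u > 0 \<and> v > 0 \<longrightarrow>
       (\<forall>x\<in>L. \<forall>y\<in>L. of_rat u *\<^sub>R x + of_rat v *\<^sub>R y \<in> affine_pos R a
          \<longrightarrow> of_rat u *\<^sub>R x + of_rat v *\<^sub>R y \<in> L))"

text \<open>For \<open>p = q = r\<close> and \<open>u + v = 1\<close> the equation in the next condition is an identity, so \<open>q \<noteq> r\<close> has
  to be required there; for \<open>u = v = 1\<close> it holds automatically.\<close>

definition cond_b' :: "('a::euclidean_space \<times> real) list \<Rightarrow> bool" where
  "cond_b' xs \<longleftrightarrow>
     (\<forall>u v :: rat. u > 0 \<and> v > 0 \<longrightarrow>
       (\<forall>p<length xs. \<forall>q<length xs. \<forall>r<length xs.
          q \<noteq> r \<and> xs ! p = of_rat u *\<^sub>R (xs ! q) + of_rat v *\<^sub>R (xs ! r) \<longrightarrow> between p q r))"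

definition cond_c' :: "'a::euclidean_space set \<Rightarrow> (nat \<Rightarrow> 'a) \<Rightarrow> ('a \<times> real) set \<Rightarrow> bool" where
  "cond_c' R a L \<longleftrightarrow>
     (\<forall>u v :: rat. u > 0 \<and> v > 0 \<longrightarrow>
       (\<forall>x\<in>L. \<forall>\<beta>\<in>affine_pos R a. \<forall>\<gamma>\<in>affine_pos R a.
          x = of_rat u *\<^sub>R \<beta> + of_rat v *\<^sub>R \<gamma> \<longrightarrow> \<beta> \<in> L \<or> \<gamma> \<in> L))"

definition cond_d' :: "'a::euclidean_space set \<Rightarrow> (nat \<Rightarrow> 'a) \<Rightarrow> ('a \<times> real) list \<Rightarrow> bool" where
  "cond_d' R a xs \<longleftrightarrow>
     (\<forall>u v :: rat. u > 0 \<and> v > 0 \<longrightarrow>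
       (\<forall>p<length xs. \<forall>q<length xs. \<forall>\<gamma>\<in>affine_pos R a.
          \<gamma> \<notin> set xs \<and> xs ! p = of_rat u *\<^sub>R (xs ! q) + of_rat v *\<^sub>R \<gamma> \<longrightarrow> q < p))"

definition conds_abcd :: "'a::euclidean_space set \<Rightarrow> (nat \<Rightarrow> 'a) \<Rightarrow> ('a \<times> real) list \<Rightarrow> bool" where
  "conds_abcd R a xs \<longleftrightarrow> cond_a R a (set xs) \<and> cond_b xs \<and> cond_c R a (set xs) \<and> cond_d R a xs"

definition conds_abcd' :: "'a::euclidean_space set \<Rightarrow> (nat \<Rightarrow> 'a) \<Rightarrow> ('a \<times> real) list \<Rightarrow> bool" where
  "conds_abcd' R a xs \<longleftrightarrow>
     cond_a' R a (set xs) \<and> cond_b' xs \<and> cond_c' R a (set xs) \<and> cond_d' R a xs"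

definition conds_abcdef :: "'a::euclidean_space set \<Rightarrow> (nat \<Rightarrow> 'a) \<Rightarrow> ('a \<times> real) list \<Rightarrow> bool" where
  "conds_abcdef R a xs \<longleftrightarrow> conds_abcd R a xs \<and> cond_e R a (set xs) \<and> cond_f xs"

definition good_orderings ::
    "'a::euclidean_space set \<Rightarrow> (nat \<Rightarrow> 'a) \<Rightarrow> ('a \<times> real) set \<Rightarrow> ('a \<times> real) list set" where
  "good_orderings R a L =
     {xs. distinct xs \<and> set xs = L \<and> cond_b xs \<and> cond_d R a xs \<and> cond_f xs}"

end

(*
Since some linear functional is positive exactly on the positive affine roots, lambda(w) consists of
the positive roots x on which this functional, composed with w, is negative. Hence lambda(w) and its
complement are closed under positive combinations, and lambda(w) is closed under lowering the level.
The initial segments of the sequence of a reduced word are again sets lambda(w'), and applying these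
closure properties to them yields the conditions on the order.

Conversely, in rank at least two each positive affine root is simple or a sum of two positive affine
roots. If a sequence satisfies (a)-(d), its first root is therefore simple, say alpha_i: a sum would
contradict (c) together with (b) or (d). Dropping alpha_i and applying s_i to the remaining roots
preserves (a)-(d), so induction on the length produces the word. The conditions (e), (f) and (a')-(d')
then follow from (a)-(d), because they hold for all sequences of reduced words. The same descent,
starting from a root of least height, represents a finite set satisfying (a) and (c) as some lambda(w).
In rank one, where no sum of two affine roots is an affine root, (e) and (f) show that the first root
is simple.
*)

theory Submission
  imports Defs
begin

subsection \<open>Finite roots\<close>

text \<open>The obstacle is the splitting of positive affine roots. Along \<alpha> = \<beta> +
  \<gamma> the levels must be multiples of \<nu> at \<beta> and at \<gamma>, and both parts must
  stay positive, so with two root lengths the level cannot be divided freely. Two kinds of summands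
  are safe: a finite positive root \<gamma> at level 0 with (\<alpha>, \<gamma>) > 0, which leaves
  the whole level to \<alpha> - \<gamma>, and [-\<theta>, 1] when (\<alpha>, \<theta>) < 0, which
  leaves a short root, where every integer is a level. If neither kind applies to a root of positive
  level whose finite part is negative, then -\<alpha> is dominant and in fact \<alpha> = -\<theta>.
  This last step needs \<theta> to pair positively with every dominant root, long or short, and
  rests on irreducibility. The remaining roots [-\<theta>, j] with j at least 2 are split through a
  root that is neither proportional nor orthogonal to \<theta>, which exists only in rank at least
  two.\<close>

locale root_datum =
  fixes R :: "'a::euclidean_space set" and a :: "nat \<Rightarrow> 'a" and \<theta> :: 'a
  assumes root_system: "reduced_root_system R"
    and irreducible: "irreducible_roots R"
    and normalized: "normalized_form R"
    and simple: "simple_roots R a"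
    and maximal: "maximal_short_root R a \<theta>"
begin

abbreviation "Pos \<equiv> positive_roots R a"

section \<open>Reflections, Cartan integers and differences of roots\<close>

lemma finite_R: "finite R" and span_R: "span R = UNIV" and zero_notin_R: "0 \<notin> R"
  using root_system by (auto simp: reduced_root_system_def)

lemma reflection_in_R: "\<alpha> \<in> R \<Longrightarrow> \<beta> \<in> R \<Longrightarrow> \<beta> - (\<beta> \<bullet> coroot \<alpha>) *\<^sub>R \<alpha> \<in> R"
  using root_system by (auto simp: reduced_root_system_def)

lemma inner_coroot_Ints: "\<alpha> \<in> R \<Longrightarrow> \<beta> \<in> R \<Longrightarrow> \<beta> \<bullet> coroot \<alpha> \<in> \<int>"
  using root_system by (auto simp: reduced_root_system_def)

lemma scaleR_in_R: "\<alpha> \<in> R \<Longrightarrow> c *\<^sub>R \<alpha> \<in> R \<Longrightarrow> c = 1 \<or> c = -1"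
  using root_system by (auto simp: reduced_root_system_def)

lemma inner_root_pos: "\<alpha> \<in> R \<Longrightarrow> \<alpha> \<bullet> \<alpha> > 0"
  using zero_notin_R by auto

lemma inner_coroot: "\<beta> \<bullet> coroot \<alpha> = 2 * (\<beta> \<bullet> \<alpha>) / (\<alpha> \<bullet> \<alpha>)"
  by (simp add: coroot_def)

lemma uminus_in_R: "\<alpha> \<in> R \<Longrightarrow> - \<alpha> \<in> R"
  using reflection_in_R[of \<alpha> \<alpha>] inner_root_pos[of \<alpha>]
  by (simp add: inner_coroot algebra_simps scaleR_2)

lemma norm_reflection:
  assumes "\<alpha> \<in> R"
  shows "(\<beta> - (\<beta> \<bullet> coroot \<alpha>) *\<^sub>R \<alpha>) \<bullet> (\<beta> - (\<beta> \<bullet> coroot \<alpha>) *\<^sub>R \<alpha>) = \<beta> \<bullet> \<beta>"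
  using inner_root_pos[OF assms]
  by (simp add: inner_coroot inner_diff_left inner_diff_right inner_commute field_simps)

text \<open>Equality would make \<beta> equal to its projection
  \<open>?c *\<^sub>R \<alpha>\<close>, and a reduced system has only \<alpha> and -\<alpha> on that
  line.\<close>

lemma strict_Cauchy_Schwarz:
  assumes "\<alpha> \<in> R" "\<beta> \<in> R" "\<beta> \<noteq> \<alpha>" "\<beta> \<noteq> - \<alpha>"
  shows "(\<alpha> \<bullet> \<beta>)\<^sup>2 < (\<alpha> \<bullet> \<alpha>) * (\<beta> \<bullet> \<beta>)"
proof -
  let ?c = "(\<alpha> \<bullet> \<beta>) / (\<alpha> \<bullet> \<alpha>)"
  have p: "\<alpha> \<bullet> \<alpha> > 0" using inner_root_pos[OF assms(1)] .
  have "\<beta> \<noteq> ?c *\<^sub>R \<alpha>"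
  proof
    assume *: "\<beta> = ?c *\<^sub>R \<alpha>"
    with assms(2) have "?c *\<^sub>R \<alpha> \<in> R" by simp
    from scaleR_in_R[OF assms(1) this] have "?c = 1 \<or> ?c = -1" .
    with * assms(3,4) show False by (metis scaleR_one scaleR_minus1_left)
  qed
  then have "(\<beta> - ?c *\<^sub>R \<alpha>) \<bullet> (\<beta> - ?c *\<^sub>R \<alpha>) > 0" by simp
  also have "(\<beta> - ?c *\<^sub>R \<alpha>) \<bullet> (\<beta> - ?c *\<^sub>R \<alpha>) = \<beta> \<bullet> \<beta> - (\<alpha> \<bullet> \<beta>)\<^sup>2 / (\<alpha> \<bullet> \<alpha>)"
    using p by (simp add: inner_diff_left inner_diff_right inner_commute field_simps power2_eq_square)
  finally show ?thesis using p by (simp add: field_simps)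
qed

text \<open>The two Cartan integers are positive with product below 4, so one of them is 1 and the
  difference is a reflected root up to sign. It is then as long as \<alpha>, or as long as \<gamma>
  with \<nu> \<alpha> a multiple of \<nu> \<gamma>. The divisibility is what makes every level of
  \<alpha> a level of \<alpha> - \<gamma> as well.\<close>

lemma root_diff:
  assumes "\<alpha> \<in> R" "\<gamma> \<in> R" "\<alpha> \<noteq> \<gamma>" "\<alpha> \<bullet> \<gamma> > 0"
  shows "\<alpha> - \<gamma> \<in> R" and "\<exists>k::int. \<nu> \<alpha> = of_int k * \<nu> (\<alpha> - \<gamma>)"
proof -
  have a: "\<alpha> \<bullet> \<alpha> > 0" and g: "\<gamma> \<bullet> \<gamma> > 0" using assms inner_root_pos by auto
  obtain p q :: int where p: "\<alpha> \<bullet> coroot \<gamma> = of_int p" and q: "\<gamma> \<bullet> coroot \<alpha> = of_int q"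
    using inner_coroot_Ints assms(1,2) by (metis Ints_cases)
  have "\<alpha> \<noteq> - \<gamma>"
  proof
    assume "\<alpha> = - \<gamma>"
    then have "\<alpha> \<bullet> \<gamma> = - (\<gamma> \<bullet> \<gamma>)" by simp
    with assms(4) g show False by linarith
  qed
  then have "(\<gamma> \<bullet> \<alpha>)\<^sup>2 < (\<gamma> \<bullet> \<gamma>) * (\<alpha> \<bullet> \<alpha>)"
    using strict_Cauchy_Schwarz[OF assms(2,1)] assms(3) by simp
  then have "(\<alpha> \<bullet> coroot \<gamma>) * (\<gamma> \<bullet> coroot \<alpha>) < 4"
    using a g by (simp add: inner_coroot inner_commute field_simps power2_eq_square)
  moreover have pq: "\<alpha> \<bullet> coroot \<gamma> > 0" "\<gamma> \<bullet> coroot \<alpha> > 0"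
    using assms(4) a g by (simp_all add: inner_coroot inner_commute)
  ultimately have "real_of_int (p * q) < 4" "p > 0" "q > 0" using p q by simp_all
  then have pq4: "p * q < 4" "p > 0" "q > 0" by linarith+
  have "p = 1 \<or> q = 1"
  proof (rule ccontr)
    assume "\<not> ?thesis"
    with pq4 have "p \<ge> 2" "q \<ge> 2" by auto
    then have "2 * 2 \<le> p * q" by (intro mult_mono) auto
    with pq4 show False by simp
  qed
  then have "\<alpha> - \<gamma> \<in> R \<and> (\<exists>k::int. \<nu> \<alpha> = of_int k * \<nu> (\<alpha> - \<gamma>))"
  proof
    assume "p = 1"
    then have "\<alpha> - \<gamma> \<in> R" "(\<alpha> - \<gamma>) \<bullet> (\<alpha> - \<gamma>) = \<alpha> \<bullet> \<alpha>"
      using reflection_in_R[OF assms(2,1)] norm_reflection[OF assms(2), of \<alpha>] p by simp_all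
    then show ?thesis by (auto simp: \<nu>_def intro!: exI[of _ 1])
  next
    assume q1: "q = 1"
    then have "\<gamma> - \<alpha> \<in> R" "(\<gamma> - \<alpha>) \<bullet> (\<gamma> - \<alpha>) = \<gamma> \<bullet> \<gamma>"
      using reflection_in_R[OF assms(1,2)] norm_reflection[OF assms(1), of \<gamma>] q by simp_all
    moreover have "(\<alpha> - \<gamma>) \<bullet> (\<alpha> - \<gamma>) = (\<gamma> - \<alpha>) \<bullet> (\<gamma> - \<alpha>)"
      by (simp add: inner_diff_left inner_diff_right inner_commute)
    moreover have "\<alpha> \<bullet> \<alpha> = of_int p * (\<gamma> \<bullet> \<gamma>)"
      using p q q1 a g by (simp add: inner_coroot inner_commute field_simps)
    ultimately show ?thesis using uminus_in_R[of "\<gamma> - \<alpha>"]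
      by (auto simp: \<nu>_def intro!: exI[of _ p])
  qed
  then show "\<alpha> - \<gamma> \<in> R" "\<exists>k::int. \<nu> \<alpha> = of_int k * \<nu> (\<alpha> - \<gamma>)" by auto
qed

section \<open>Simple-root coordinates and positive roots\<close>

lemma simple_in_R: "i \<in> {1..DIM('a)} \<Longrightarrow> a i \<in> R"
  and inj_simple: "inj_on a {1..DIM('a)}"
  and independent_simple: "independent (a ` {1..DIM('a)})"
  using simple by (auto simp: simple_roots_def)

text \<open>Coordinates are global linear functionals, not coefficients of one given expansion, so
  that they apply directly to differences and reflections of roots.\<close>

definition crd :: "nat \<Rightarrow> 'a \<Rightarrow> real" where
  "crd k = (SOME f. linear f \<and> (\<forall>i\<in>{1..DIM('a)}. f (a i) = (if i = k then 1 else 0)))"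

lemma crd: "linear (crd k)" "i \<in> {1..DIM('a)} \<Longrightarrow> crd k (a i) = (if i = k then 1 else 0)"
proof -
  have "\<exists>f. linear f \<and> (\<forall>i\<in>{1..DIM('a)}. f (a i) = (if i = k then 1 else (0::real)))"
  proof -
    obtain g :: "'a \<Rightarrow> real" where g: "linear g"
      "\<forall>x\<in>a ` {1..DIM('a)}. g x = (if inv_into {1..DIM('a)} a x = k then 1 else 0)"
      using linear_independent_extend[OF independent_simple,
          of "\<lambda>x. if inv_into {1..DIM('a)} a x = k then 1 else (0::real)"] by blast
    have "g (a i) = (if i = k then 1 else 0)" if "i \<in> {1..DIM('a)}" for i
      using g(2) that inv_into_f_f[OF inj_simple that] by simp
    with g(1) show ?thesis by blast
  qed
  from someI_ex[OF this]
  show "linear (crd k)" "i \<in> {1..DIM('a)} \<Longrightarrow> crd k (a i) = (if i = k then 1 else 0)"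
    by (auto simp: crd_def)
qed

lemma crd_sum:
  assumes "k \<in> {1..DIM('a)}"
  shows "crd k (\<Sum>i\<in>{1..DIM('a)}. c i *\<^sub>R a i) = c k"
proof -
  have "crd k (\<Sum>i\<in>{1..DIM('a)}. c i *\<^sub>R a i) = (\<Sum>i\<in>{1..DIM('a)}. c i * crd k (a i))"
    by (simp add: linear_sum[OF crd(1)] linear_scale[OF crd(1)])
  also have "\<dots> = (\<Sum>i\<in>{1..DIM('a)}. if i = k then c i else 0)"
    by (intro sum.cong) (auto simp: crd(2))
  also have "\<dots> = c k" using assms by simp
  finally show ?thesis .
qed

lemma Pos_expand:
  assumes "\<beta> \<in> Pos"
  shows "\<beta> = (\<Sum>i\<in>{1..DIM('a)}. crd i \<beta> *\<^sub>R a i)" and "i \<in> {1..DIM('a)} \<Longrightarrow> crd i \<beta> \<ge> 0"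
proof -
  obtain c :: "nat \<Rightarrow> nat" where c: "\<beta> = (\<Sum>i\<in>{1..DIM('a)}. real (c i) *\<^sub>R a i)"
    using assms by (auto simp: positive_roots_def nonneg_comb_def)
  then have *: "crd i \<beta> = real (c i)" if "i \<in> {1..DIM('a)}" for i
    using crd_sum[OF that, of "\<lambda>i. real (c i)"] by simp
  show "\<beta> = (\<Sum>i\<in>{1..DIM('a)}. crd i \<beta> *\<^sub>R a i)" by (subst c) (auto intro!: sum.cong simp: *)
  show "i \<in> {1..DIM('a)} \<Longrightarrow> crd i \<beta> \<ge> 0" using * by simp
qed

lemma Pos_in_R: "\<beta> \<in> Pos \<Longrightarrow> \<beta> \<in> R"
  by (simp add: positive_roots_def)

lemma Pos_or_neg: "\<beta> \<in> R \<Longrightarrow> \<beta> \<in> Pos \<or> - \<beta> \<in> Pos"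
  using simple uminus_in_R by (auto simp: simple_roots_def positive_roots_def)

definition hgt :: "'a \<Rightarrow> real" where "hgt \<beta> = (\<Sum>i\<in>{1..DIM('a)}. crd i \<beta>)"

lemma linear_hgt: "linear hgt"
  unfolding hgt_def[abs_def]
  by (intro linear_compose_sum ballI crd(1))

lemma hgt_pos:
  assumes "\<beta> \<in> Pos" shows "hgt \<beta> > 0"
proof (rule ccontr)
  assume "\<not> ?thesis"
  then have "hgt \<beta> \<le> 0" by simp
  moreover have "hgt \<beta> \<ge> 0" unfolding hgt_def using Pos_expand(2)[OF assms] by (intro sum_nonneg) auto
  ultimately have "hgt \<beta> = 0" by simp
  then have "\<forall>i\<in>{1..DIM('a)}. crd i \<beta> = 0"
    unfolding hgt_def using Pos_expand(2)[OF assms] by (subst (asm) sum_nonneg_eq_0_iff) auto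
  with Pos_expand(1)[OF assms] have "\<beta> = 0" by simp
  with assms zero_notin_R show False by (auto simp: positive_roots_def)
qed

lemma not_Pos_uminus: "\<beta> \<in> Pos \<Longrightarrow> - \<beta> \<notin> Pos"
  using hgt_pos[of \<beta>] hgt_pos[of "- \<beta>"] linear_neg[OF linear_hgt, of \<beta>] by auto

lemma simple_in_Pos:
  assumes "i \<in> {1..DIM('a)}" shows "a i \<in> Pos"
proof (rule ccontr)
  assume "a i \<notin> Pos"
  then have "- a i \<in> Pos" using Pos_or_neg simple_in_R assms by blast
  then have "crd i (- a i) \<ge> 0" using Pos_expand(2) assms by blast
  moreover have "crd i (- a i) = - 1" using crd(2)[OF assms, of i] linear_neg[OF crd(1), of i "a i"] by simp
  ultimately show False by simp
qed

text \<open>Some coefficient of \<open>\<beta>\<close> at a simple root other than \<open>a i\<close> is positive and does not change.\<close>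

lemma Pos_minus_simple:
  assumes "i \<in> {1..DIM('a)}" "\<beta> \<in> Pos" "\<beta> \<noteq> a i" "\<beta> - c *\<^sub>R a i \<in> R"
  shows "\<beta> - c *\<^sub>R a i \<in> Pos"
proof (rule ccontr)
  assume "\<not> ?thesis"
  then have n: "- (\<beta> - c *\<^sub>R a i) \<in> Pos" using Pos_or_neg assms(4) by blast
  have "crd k \<beta> = 0" if k: "k \<in> {1..DIM('a)}" "k \<noteq> i" for k
  proof -
    have "crd k (- (\<beta> - c *\<^sub>R a i)) = - crd k \<beta>"
      using crd(2)[OF assms(1), of k] k
      by (simp add: linear_neg[OF crd(1)] linear_diff[OF crd(1)] linear_scale[OF crd(1)])
    then show ?thesis using Pos_expand(2)[OF n k(1)] Pos_expand(2)[OF assms(2) k(1)] by simp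
  qed
  then have "(\<Sum>k\<in>{1..DIM('a)}. crd k \<beta> *\<^sub>R a k) = (\<Sum>k\<in>{1..DIM('a)}. if k = i then crd i \<beta> *\<^sub>R a i else 0)"
    by (intro sum.cong) auto
  with Pos_expand(1)[OF assms(2)]
  have "\<beta> = (\<Sum>k\<in>{1..DIM('a)}. if k = i then crd i \<beta> *\<^sub>R a i else 0)" by (rule trans)
  then have e: "\<beta> = crd i \<beta> *\<^sub>R a i" using assms(1) by simp
  then have "crd i \<beta> = 1 \<or> crd i \<beta> = -1"
    using scaleR_in_R simple_in_R assms(1,2) Pos_in_R by metis
  then have "crd i \<beta> = 1" using Pos_expand(2)[OF assms(2,1)] by auto
  with e assms(3) show False by simp
qed

text \<open>If no simple root paired positively with \<beta>, the expansion of \<beta> with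
  nonnegative coefficients would give (\<beta>, \<beta>) \<le> 0. Subtracting a simple root that
  does pair positively gives a root by \<open>root_diff\<close>, and its sign does not
  change.\<close>

lemma Pos_nonsimple_split:
  assumes "\<beta> \<in> Pos" "\<beta> \<notin> a ` {1..DIM('a)}"
  shows "\<exists>i\<in>{1..DIM('a)}. \<beta> - a i \<in> Pos"
proof -
  have "\<exists>i\<in>{1..DIM('a)}. \<beta> \<bullet> a i > 0"
  proof (rule ccontr)
    assume "\<not> ?thesis"
    then have "\<forall>i\<in>{1..DIM('a)}. \<beta> \<bullet> a i \<le> 0" by (auto simp: not_less)
    then have "(\<Sum>i\<in>{1..DIM('a)}. crd i \<beta> * (\<beta> \<bullet> a i)) \<le> 0"
      using Pos_expand(2)[OF assms(1)] by (intro sum_nonpos) (auto simp: mult_nonneg_nonpos)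
    moreover have "(\<Sum>i\<in>{1..DIM('a)}. crd i \<beta> * (\<beta> \<bullet> a i)) = \<beta> \<bullet> (\<Sum>i\<in>{1..DIM('a)}. crd i \<beta> *\<^sub>R a i)"
      by (simp add: inner_sum_right)
    ultimately have "\<beta> \<bullet> \<beta> \<le> 0" by (simp only: Pos_expand(1)[OF assms(1), symmetric])
    then show False using inner_root_pos[OF Pos_in_R[OF assms(1)]] by linarith
  qed
  then obtain i where i: "i \<in> {1..DIM('a)}" "\<beta> \<bullet> a i > 0" by blast
  have ne: "\<beta> \<noteq> a i" using i(1) assms(2) by blast
  have "\<beta> - a i \<in> R" using root_diff(1)[OF Pos_in_R[OF assms(1)] simple_in_R[OF i(1)] ne i(2)] .
  then have "\<beta> - a i \<in> Pos" using Pos_minus_simple[OF i(1) assms(1) ne, of 1] by simp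
  with i(1) show ?thesis by blast
qed

section \<open>The maximal short root\<close>

lemma theta_in_R: "\<theta> \<in> R" and theta_norm: "\<theta> \<bullet> \<theta> = 2"
  using maximal normalized by (auto simp: maximal_short_root_def normalized_form_def short_root_def)

lemma theta_short: "\<beta> \<in> R \<Longrightarrow> \<beta> \<bullet> \<beta> \<ge> 2"
  using maximal theta_norm by (auto simp: maximal_short_root_def short_root_def)

lemma nu_theta [simp]: "\<nu> \<theta> = 1" "\<nu> (- \<theta>) = 1"
  by (simp_all add: \<nu>_def theta_norm)

lemma coroot_theta: "coroot \<theta> = \<theta>" "coroot (- \<theta>) = - \<theta>"
  by (simp_all add: coroot_def theta_norm)

text \<open>Otherwise the reflection in \<open>a i\<close> would add a positive integral multiple of
  \<open>a i\<close> to \<theta> and produce a larger short root.\<close>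

lemma inner_theta_simple:
  assumes i: "i \<in> {1..DIM('a)}"
  shows "\<theta> \<bullet> a i \<ge> 0"
proof (rule ccontr)
  assume n: "\<not> ?thesis"
  let ?c = "\<theta> \<bullet> coroot (a i)"
  have p: "a i \<bullet> a i > 0" using simple_in_R[OF i] inner_root_pos by auto
  have c: "?c < 0" using n p by (simp add: inner_coroot divide_neg_pos)
  obtain m :: int where m: "?c = of_int m" using inner_coroot_Ints[OF simple_in_R[OF i] theta_in_R] by (metis Ints_cases)
  let ?t = "\<theta> - ?c *\<^sub>R a i"
  have "short_root R ?t"
    using maximal reflection_in_R[OF simple_in_R[OF i] theta_in_R] norm_reflection[OF simple_in_R[OF i], of \<theta>]
    by (auto simp: maximal_short_root_def short_root_def)
  moreover have "?t - \<theta> \<in> nonneg_comb a"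
  proof -
    have "(\<Sum>k\<in>{1..DIM('a)}. real (if k = i then nat (- m) else 0) *\<^sub>R a k)
        = (\<Sum>k\<in>{1..DIM('a)}. if k = i then real (nat (- m)) *\<^sub>R a k else 0)"
      by (intro sum.cong) auto
    also have "\<dots> = real (nat (- m)) *\<^sub>R a i" using i by simp
    also have "\<dots> = ?t - \<theta>" using c m by simp
    finally have "?t - \<theta> = (\<Sum>k\<in>{1..DIM('a)}. real (if k = i then nat (- m) else 0) *\<^sub>R a k)" by simp
    then show ?thesis unfolding nonneg_comb_def mem_Collect_eq
      by (intro exI[of _ "\<lambda>k. if k = i then nat (- m) else 0"]) simp
  qed
  ultimately have "?t = \<theta>" using maximal by (auto simp: maximal_short_root_def)
  then have "?c *\<^sub>R a i = 0" by (metis diff_eq_eq add_cancel_right_right)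
  with c p show False by auto
qed

lemma inner_theta_Pos:
  assumes "\<beta> \<in> Pos" shows "\<theta> \<bullet> \<beta> \<ge> 0"
proof -
  have "\<theta> \<bullet> \<beta> = (\<Sum>i\<in>{1..DIM('a)}. crd i \<beta> * (\<theta> \<bullet> a i))"
    by (subst Pos_expand(1)[OF assms]) (simp add: inner_sum_right)
  also have "\<dots> \<ge> 0" using Pos_expand(2)[OF assms] inner_theta_simple by (intro sum_nonneg) auto
  finally show ?thesis .
qed

lemma theta_Pos: "\<theta> \<in> Pos"
  using Pos_or_neg[OF theta_in_R] inner_theta_Pos[of "- \<theta>"] theta_norm by auto

lemma Pos_if_inner_theta: "\<beta> \<in> R \<Longrightarrow> \<theta> \<bullet> \<beta> > 0 \<Longrightarrow> \<beta> \<in> Pos"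
  using Pos_or_neg[of \<beta>] inner_theta_Pos[of "- \<beta>"] by auto

text \<open>Shortness of \<theta> gives 2 \<le> (\<beta>, \<beta>), so strict Cauchy-Schwarz yields
  |(\<theta>, \<beta>)| < (\<beta>, \<beta>): the Cartan integer has absolute value below 2.\<close>

lemma inner_theta_coroot:
  assumes "\<beta> \<in> R" "\<beta> \<noteq> \<theta>" "\<beta> \<noteq> - \<theta>"
  shows "\<theta> \<bullet> coroot \<beta> \<in> {-1, 0, 1}"
proof -
  have b: "\<beta> \<bullet> \<beta> \<ge> 2" using theta_short assms by simp
  have "(\<theta> \<bullet> \<beta>)\<^sup>2 < 2 * (\<beta> \<bullet> \<beta>)" using strict_Cauchy_Schwarz[OF theta_in_R assms(1)] assms theta_norm by simp
  also have "\<dots> \<le> (\<beta> \<bullet> \<beta>)\<^sup>2" unfolding power2_eq_square using b by (intro mult_right_mono) auto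
  finally have "\<bar>\<theta> \<bullet> \<beta>\<bar> < \<bar>\<beta> \<bullet> \<beta>\<bar>" using abs_le_square_iff[of "\<beta> \<bullet> \<beta>" "\<theta> \<bullet> \<beta>"] by linarith
  then have "\<bar>\<theta> \<bullet> \<beta>\<bar> < \<beta> \<bullet> \<beta>" using b by simp
  moreover have "\<beta> \<bullet> \<beta> > 0" using b by linarith
  ultimately have "\<bar>\<theta> \<bullet> coroot \<beta>\<bar> < 2" by (simp add: inner_coroot abs_mult divide_less_eq)
  moreover obtain m :: int where m: "\<theta> \<bullet> coroot \<beta> = of_int m" using inner_coroot_Ints[OF assms(1) theta_in_R] by (metis Ints_cases)
  ultimately have "\<bar>m\<bar> < 2" by linarith
  then have "m \<in> {-1,0,1}" by auto
  then show ?thesis using m by auto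
qed

text \<open>The Cartan integer of \<theta> against \<beta> is 1, while the other one is (\<theta>,
  \<beta>) itself because \<theta> is its own coroot. Hence \<nu> \<beta> is an integer, and \<beta>
  - \<theta> is short whatever the length of \<beta>.\<close>

lemma inner_theta_pos_eq:
  assumes "\<beta> \<in> R" "\<beta> \<noteq> \<theta>" "\<theta> \<bullet> \<beta> > 0"
  shows "\<theta> \<bullet> \<beta> = \<nu> \<beta>" "\<exists>m::int. m \<ge> 1 \<and> \<nu> \<beta> = of_int m" "\<beta> - \<theta> \<in> R"
    "(\<beta> - \<theta>) \<bullet> (\<beta> - \<theta>) = 2"
proof -
  have "\<beta> \<bullet> \<beta> > 0" using inner_root_pos assms by auto
  then have "\<theta> \<bullet> coroot \<beta> > 0" using assms(3) by (simp add: inner_coroot)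
  moreover have "\<beta> \<noteq> - \<theta>" using assms(3) theta_norm by auto
  ultimately have c: "\<theta> \<bullet> coroot \<beta> = 1" using inner_theta_coroot[OF assms(1,2)] by auto
  then show 1: "\<theta> \<bullet> \<beta> = \<nu> \<beta>" using inner_root_pos assms(1) by (auto simp: inner_coroot \<nu>_def field_simps)
  obtain m :: int where "\<beta> \<bullet> coroot \<theta> = of_int m" using inner_coroot_Ints[OF theta_in_R assms(1)] by (metis Ints_cases)
  then have m: "\<theta> \<bullet> \<beta> = of_int m" by (simp add: coroot_theta inner_commute)
  moreover have "m \<ge> 1" using m assms(3) by simp
  ultimately show "\<exists>m::int. m \<ge> 1 \<and> \<nu> \<beta> = of_int m" using 1 by auto
  show "\<beta> - \<theta> \<in> R" using assms theta_in_R by (intro root_diff(1)) (auto simp: inner_commute)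
  show "(\<beta> - \<theta>) \<bullet> (\<beta> - \<theta>) = 2" using 1 theta_norm
    by (simp add: \<nu>_def inner_diff_left inner_diff_right inner_commute)
qed

text \<open>The roots linked to \<theta> in this way form a set S containing \<theta>. If S were not
  R, irreducibility would give nonorthogonal \<alpha> in S and \<delta> outside it, with some
  \<gamma> linking \<alpha> to \<theta>. Since neither \<alpha> nor \<gamma> links \<delta> to
  \<theta>, \<alpha> is orthogonal to \<theta> and \<gamma> to \<delta>; but then \<gamma> reflected
  in \<alpha> is a link.\<close>

lemma common_neighbour:
  assumes "\<beta> \<in> R"
  shows "\<exists>\<gamma>\<in>R. \<gamma> \<bullet> \<theta> \<noteq> 0 \<and> \<gamma> \<bullet> \<beta> \<noteq> 0"
proof -
  define S where "S = {\<beta>\<in>R. \<exists>\<gamma>\<in>R. \<gamma> \<bullet> \<theta> \<noteq> 0 \<and> \<gamma> \<bullet> \<beta> \<noteq> 0}"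
  have ne: "S \<noteq> {}" using theta_in_R theta_norm by (force simp: S_def)
  have "S = R"
  proof (rule ccontr)
    assume "S \<noteq> R"
    moreover have "S \<subseteq> R" by (auto simp: S_def)
    ultimately obtain \<alpha> \<delta> where ad: "\<alpha> \<in> S" "\<delta> \<in> R - S" "\<alpha> \<bullet> \<delta> \<noteq> 0"
      using irreducible ne unfolding irreducible_roots_def by blast
    then obtain \<gamma> where g: "\<gamma> \<in> R" "\<gamma> \<bullet> \<theta> \<noteq> 0" "\<gamma> \<bullet> \<alpha> \<noteq> 0" and aR: "\<alpha> \<in> R" by (auto simp: S_def)
    have out: "\<gamma>' \<bullet> \<theta> = 0 \<or> \<gamma>' \<bullet> \<delta> = 0" if "\<gamma>' \<in> R" for \<gamma>' using ad(2) that by (auto simp: S_def)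
    have a0: "\<alpha> \<bullet> \<theta> = 0" using out[OF aR] ad(3) by auto
    have g0: "\<gamma> \<bullet> \<delta> = 0" using out[OF g(1)] g by auto
    have "\<alpha> \<bullet> \<alpha> > 0" using inner_root_pos aR by auto
    then have "\<gamma> \<bullet> coroot \<alpha> \<noteq> 0" using g by (simp add: inner_coroot)
    then show False using out[OF reflection_in_R[OF aR g(1)]] a0 g0 g ad(3)
      by (simp add: inner_diff_left)
  qed
  then show ?thesis using assms by (auto simp: S_def)
qed

text \<open>If \<open>\<mu>\<close> were orthogonal to \<open>\<theta>\<close>, a common neighbour \<open>\<gamma>\<close> would make \<open>\<gamma> - \<theta>\<close> a positive root; the value of
  \<open>\<nu> \<gamma> \<in> {1, 2, 3, \<dots>}\<close> then decides where \<open>\<theta>\<close> fails to be dominant.\<close>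

lemma dominant_inner_theta:
  assumes m: "\<mu> \<in> R" "\<And>\<gamma>. \<gamma> \<in> Pos \<Longrightarrow> \<mu> \<bullet> \<gamma> \<ge> 0"
  shows "\<theta> \<bullet> \<mu> > 0"
proof (rule ccontr)
  assume n: "\<not> ?thesis"
  have "\<mu> \<in> Pos" using Pos_or_neg[OF m(1)] m(2)[of "- \<mu>"] inner_root_pos[OF m(1)] by auto
  with n inner_theta_Pos have mt: "\<mu> \<bullet> \<theta> = 0" by (simp add: inner_commute order_antisym)
  have neg: "- \<beta> \<in> Pos" if "\<beta> \<in> R" "\<mu> \<bullet> \<beta> < 0" for \<beta> using that m(2)[of \<beta>] Pos_or_neg[of \<beta>] by auto
  have key: "\<gamma> - \<theta> \<in> R \<and> \<gamma> - \<theta> \<in> Pos \<and> \<theta> \<bullet> \<gamma> = \<nu> \<gamma>"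
    if g: "\<gamma> \<in> R" "\<theta> \<bullet> \<gamma> > 0" "\<mu> \<bullet> \<gamma> > 0" for \<gamma>
  proof -
    have "\<gamma> \<noteq> \<theta>" using g mt by auto
    from inner_theta_pos_eq[OF g(1) this g(2)] have *: "\<theta> \<bullet> \<gamma> = \<nu> \<gamma>" "\<gamma> - \<theta> \<in> R" by auto
    moreover have "- (\<theta> - \<gamma>) \<in> Pos"
      using g mt uminus_in_R[OF *(2)] by (intro neg) (simp_all add: inner_diff_right)
    ultimately show ?thesis by simp
  qed
  \<comment> \<open>Here \<gamma> - \<theta> is a positive root, yet its product with \<theta> is 1
    - 2.\<close>
  have short: False if g: "\<gamma> \<in> R" "\<theta> \<bullet> \<gamma> > 0" "\<mu> \<bullet> \<gamma> > 0" "\<nu> \<gamma> = 1" for \<gamma>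
    using key[OF g(1-3)] inner_theta_Pos[of "\<gamma> - \<theta>"] g(4) by (simp add: inner_diff_right theta_norm)
  obtain \<gamma> where g: "\<gamma> \<in> R" "\<gamma> \<bullet> \<theta> \<noteq> 0" "\<gamma> \<bullet> \<mu> \<noteq> 0" using common_neighbour[OF m(1)] by blast
  have "\<exists>\<gamma>\<in>Pos. \<gamma> \<bullet> \<theta> \<noteq> 0 \<and> \<gamma> \<bullet> \<mu> \<noteq> 0"
    using Pos_or_neg[OF g(1)] g by (metis inner_minus_left neg_equal_0_iff_equal)
  then obtain \<gamma> where g: "\<gamma> \<in> R" "\<theta> \<bullet> \<gamma> > 0" "\<mu> \<bullet> \<gamma> > 0"
    using inner_theta_Pos m(2) Pos_in_R by (metis inner_commute order_less_le)
  have ne: "\<gamma> \<noteq> \<theta>" using g mt by auto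
  note k = key[OF g] inner_theta_pos_eq[OF g(1) ne g(2)]
  obtain m where m1: "m \<ge> 1" "\<nu> \<gamma> = of_int (m::int)" using k by blast
  let ?\<epsilon> = "\<gamma> - \<theta>"
  have e: "?\<epsilon> \<in> R" "\<nu> ?\<epsilon> = 1" "\<mu> \<bullet> ?\<epsilon> > 0" "\<theta> \<bullet> ?\<epsilon> = of_int (m - 2)"
    using k m1 g mt theta_norm by (auto simp: \<nu>_def inner_diff_right)
  consider "m = 1" | "m = 2" | "m \<ge> 3" using m1 by linarith
  then show False
  proof cases
    case 1 then show False using short[OF g] m1 by simp
  next
    case 3 then show False using short[OF e(1) _ e(3,2)] e(4) by simp
  next
    case 2
    \<comment> \<open>Now \<open>?\<epsilon>\<close> is orthogonal to \<theta>, and \<gamma>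
      reflected in it is \<open>\<theta> - ?\<epsilon>\<close>. This root pairs negatively with
      \<mu>, so its negative is positive, although that has product -2 with \<theta>.\<close>
    have ee: "?\<epsilon> \<bullet> ?\<epsilon> = 2" using e(2) by (simp add: \<nu>_def)
    have "\<gamma> \<bullet> ?\<epsilon> = 2" using ee e(4) 2 by (simp add: inner_diff_left inner_diff_right inner_commute)
    then have "\<gamma> \<bullet> coroot ?\<epsilon> = 2" using ee by (simp add: inner_coroot)
    then have "\<gamma> - 2 *\<^sub>R ?\<epsilon> \<in> R" using reflection_in_R[OF e(1) g(1)] by simp
    moreover have "\<gamma> - 2 *\<^sub>R ?\<epsilon> = \<theta> - ?\<epsilon>" by (simp add: algebra_simps scaleR_2)
    ultimately have "- (\<theta> - ?\<epsilon>) \<in> Pos" using e(3) mt by (intro neg) (simp_all add: inner_diff_right)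
    then show False using inner_theta_Pos[of "- (\<theta> - ?\<epsilon>)"] e(4) 2 theta_norm by (simp add: inner_diff_right)
  qed
qed

text \<open>Without such a root, \<alpha> and -\<alpha> would be orthogonal to all other roots,
  hence be all of R by irreducibility, and R would span at most a line.\<close>

lemma exists_neighbour:
  assumes "\<alpha> \<in> R" "DIM('a) \<ge> 2"
  shows "\<exists>\<beta>\<in>R. \<beta> \<noteq> \<alpha> \<and> \<beta> \<noteq> - \<alpha> \<and> \<beta> \<bullet> \<alpha> > 0"
proof -
  have "\<exists>\<beta>\<in>R. \<beta> \<noteq> \<alpha> \<and> \<beta> \<noteq> - \<alpha> \<and> \<beta> \<bullet> \<alpha> \<noteq> 0"
  proof (rule ccontr)
    assume n: "\<not> ?thesis"
    let ?S = "{\<alpha>, - \<alpha>}"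
    have "?S = R"
    proof (rule ccontr)
      assume "?S \<noteq> R"
      moreover have "?S \<subseteq> R" "?S \<noteq> {}" using assms uminus_in_R by auto
      ultimately obtain x y where "x \<in> ?S" "y \<in> R - ?S" "x \<bullet> y \<noteq> 0"
        using irreducible unfolding irreducible_roots_def by blast
      with n show False by (auto simp: inner_commute)
    qed
    then have "R \<subseteq> span {\<alpha>}" by (metis insert_subset empty_subsetI span_superset span_neg insertI1 subsetD)
    then have "span R \<subseteq> span {\<alpha>}" by (simp add: span_minimal)
    then have "dim (UNIV :: 'a set) \<le> dim {\<alpha>}" unfolding span_R by (metis dim_span dim_subset)
    also have "\<dots> \<le> 1" by (metis dim_le_card' finite.intros card.empty card.insert empty_iff One_nat_def)
    finally show False using assms by simp
  qed
  then obtain \<beta> where "\<beta>\<in>R" "\<beta> \<noteq> \<alpha>" "\<beta> \<noteq> - \<alpha>" "\<beta> \<bullet> \<alpha> \<noteq> 0" by blast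
  then have "\<beta> \<bullet> \<alpha> > 0 \<or> - \<beta> \<in> R \<and> - \<beta> \<noteq> \<alpha> \<and> - \<beta> \<noteq> - \<alpha> \<and> - \<beta> \<bullet> \<alpha> > 0"
    using uminus_in_R[of \<beta>] by auto
  with \<open>\<beta> \<in> R\<close> \<open>\<beta> \<noteq> \<alpha>\<close> \<open>\<beta> \<noteq> - \<alpha>\<close> show ?thesis by blast
qed

subsection \<open>Affine roots\<close>

abbreviation "Aroots \<equiv> affine_roots R"
abbreviation "Apos \<equiv> affine_pos R a"
abbreviation "asimple \<equiv> affine_simple a \<theta>"

lemma nu_ge_1: "\<alpha> \<in> R \<Longrightarrow> \<nu> \<alpha> \<ge> 1"
  using theta_short by (simp add: \<nu>_def)

lemma Aroots_iff: "(\<alpha>, t) \<in> Aroots \<longleftrightarrow> \<alpha> \<in> R \<and> (\<exists>j::int. t = \<nu> \<alpha> * of_int j)"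
  by (auto simp: affine_roots_def affine_root_def)

lemma Aroots_level_ge: "(\<alpha>, t) \<in> Aroots \<Longrightarrow> t > 0 \<Longrightarrow> t \<ge> \<nu> \<alpha>"
proof -
  assume "(\<alpha>, t) \<in> Aroots" "t > 0"
  then obtain j :: int where j: "\<alpha> \<in> R" "t = \<nu> \<alpha> * of_int j" by (auto simp: Aroots_iff)
  then have "of_int j > (0::real)" using \<open>t > 0\<close> nu_ge_1[of \<alpha>] by (simp add: zero_less_mult_iff)
  then have "of_int j \<ge> (1::real)" by simp
  then show "t \<ge> \<nu> \<alpha>" using j nu_ge_1[of \<alpha>] by simp
qed

lemma Apos_iff: "(\<alpha>, t) \<in> Apos \<longleftrightarrow> (\<alpha>, t) \<in> Aroots \<and> (t > 0 \<or> t = 0 \<and> \<alpha> \<in> Pos)"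
proof -
  have *: "(\<alpha>, t) \<in> Apos \<longleftrightarrow> t = 0 \<and> \<alpha> \<in> Pos \<or> (\<exists>j::int. t = \<nu> \<alpha> * of_int j \<and> \<alpha> \<in> R \<and> j > 0)"
    by (auto simp: affine_pos_def affine_root_def)
  show ?thesis
  proof (cases "\<alpha> \<in> R")
    case True
    then have "\<nu> \<alpha> > 0" using nu_ge_1[of \<alpha>] by simp
    then have "\<nu> \<alpha> * of_int j > 0 \<longleftrightarrow> j > 0" for j :: int by (simp add: zero_less_mult_iff)
    moreover have "\<exists>j::int. 0 = \<nu> \<alpha> * of_int j" by (rule exI[of _ 0]) simp
    ultimately show ?thesis using True unfolding * Aroots_iff by metis
  next
    case False
    then show ?thesis using Pos_in_R[of \<alpha>] unfolding * Aroots_iff by blast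
  qed
qed

lemma Apos_in_Aroots: "x \<in> Apos \<Longrightarrow> x \<in> Aroots"
  by (cases x) (simp add: Apos_iff)

lemma fst_Aroots: "x \<in> Aroots \<Longrightarrow> fst x \<in> R"
  by (cases x) (simp add: Aroots_iff)

lemma nu_uminus [simp]: "\<nu> (- \<alpha>) = \<nu> \<alpha>"
  by (simp add: \<nu>_def)

lemma uminus_in_Aroots:
  assumes "x \<in> Aroots" shows "- x \<in> Aroots"
proof (cases x)
  case (Pair \<alpha> t)
  then obtain j :: int where "\<alpha> \<in> R" "t = \<nu> \<alpha> * of_int j" using assms by (auto simp: Aroots_iff)
  then show ?thesis using Pair uminus_in_R by (auto simp: Aroots_iff intro!: exI[of _ "- j"])
qed

lemma Apos_or_neg: "x \<in> Aroots \<Longrightarrow> x \<in> Apos \<or> - x \<in> Apos"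
proof (cases x)
  case (Pair \<alpha> t)
  assume "x \<in> Aroots"
  moreover from this have "- x \<in> Aroots" by (rule uminus_in_Aroots)
  ultimately show ?thesis using Pair Pos_or_neg[of \<alpha>] fst_Aroots by (fastforce simp: Apos_iff)
qed

text \<open>Since \<open>bnd\<close> exceeds all heights of finite roots, \<open>aht\<close> separates the positive from the negative affine
  roots; \<open>\<lambda>(w)\<close> is thus cut out of the positive roots by the linear inequality \<open>aht (w x) < 0\<close>.\<close>

definition bnd :: real where "bnd = 1 + (\<Sum>\<beta>\<in>R. \<bar>hgt \<beta>\<bar>)"

definition aht :: "'a \<times> real \<Rightarrow> real" where "aht x = hgt (fst x) + bnd * snd x"

lemma bnd_gt: "\<beta> \<in> R \<Longrightarrow> \<bar>hgt \<beta>\<bar> < bnd"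
  using member_le_sum[of \<beta> R "\<lambda>\<beta>. \<bar>hgt \<beta>\<bar>"] finite_R by (simp add: bnd_def)

lemma bnd_pos: "bnd > 0"
  using bnd_gt[OF theta_in_R] by linarith

lemma aht_simps:
  "aht (x + y) = aht x + aht y" "aht (x - y) = aht x - aht y" "aht (- x) = - aht x" "aht (c *\<^sub>R x) = c * aht x"
  "aht (0, t) = bnd * t"
  by (simp_all add: aht_def linear_add[OF linear_hgt] linear_diff[OF linear_hgt] linear_neg[OF linear_hgt]
      linear_scale[OF linear_hgt] linear_0[OF linear_hgt] algebra_simps)

lemma aht_pos:
  assumes "x \<in> Apos" shows "aht x > 0"
proof (cases x)
  case (Pair \<alpha> t)
  with assms have x: "(\<alpha>, t) \<in> Aroots" "t > 0 \<or> t = 0 \<and> \<alpha> \<in> Pos" by (auto simp: Apos_iff)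
  then have aR: "\<alpha> \<in> R" by (simp add: Aroots_iff)
  from x(2) show ?thesis
  proof
    assume "t > 0"
    then have "t \<ge> 1" using Aroots_level_ge[OF x(1)] nu_ge_1[OF aR] by linarith
    then have "bnd * 1 \<le> bnd * t" using bnd_pos by (intro mult_left_mono) auto
    then show ?thesis using bnd_gt[OF aR] Pair by (simp add: aht_def)
  next
    assume "t = 0 \<and> \<alpha> \<in> Pos" then show ?thesis using hgt_pos Pair by (simp add: aht_def)
  qed
qed

lemma Apos_iff_aht: "x \<in> Aroots \<Longrightarrow> x \<in> Apos \<longleftrightarrow> aht x > 0"
  using Apos_or_neg[of x] aht_pos[of x] aht_pos[of "- x"] by (auto simp: aht_simps)

lemma neg_iff_aht: "x \<in> Aroots \<Longrightarrow> x \<in> affine_neg R a \<longleftrightarrow> aht x < 0"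
proof -
  assume "x \<in> Aroots"
  then have "x \<in> affine_neg R a \<longleftrightarrow> - x \<in> Apos" by (force simp: affine_neg_def)
  also have "\<dots> \<longleftrightarrow> aht x < 0" using Apos_iff_aht[OF uminus_in_Aroots[OF \<open>x \<in> Aroots\<close>]] by (simp add: aht_simps)
  finally show ?thesis .
qed

section \<open>Affine reflections and affine simple roots\<close>

lemma linear_affine_refl: "linear (affine_refl \<beta>)"
  by (rule linearI) (simp_all add: affine_refl_def algebra_simps inner_add_left)

lemma affine_refl_imaginary [simp]: "affine_refl \<beta> (0, t) = (0, t)"
  by (simp add: affine_refl_def)

lemma affine_refl_self: "fst \<beta> \<in> R \<Longrightarrow> affine_refl \<beta> \<beta> = - \<beta>"
  using inner_root_pos[of "fst \<beta>"] by (simp add: affine_refl_def inner_coroot scaleR_2)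

lemma affine_refl_involution:
  assumes "fst \<beta> \<in> R" shows "affine_refl \<beta> (affine_refl \<beta> x) = x"
proof -
  let ?c = "fst x \<bullet> coroot (fst \<beta>)"
  have "fst \<beta> \<bullet> coroot (fst \<beta>) = 2" using inner_root_pos[OF assms] by (simp add: inner_coroot)
  then have "affine_refl \<beta> (affine_refl \<beta> x) = x - ?c *\<^sub>R \<beta> - (?c - ?c * 2) *\<^sub>R \<beta>"
    by (simp add: affine_refl_def inner_diff_left)
  also have "\<dots> = x" by (simp add: scaleR_left.diff)
  finally show ?thesis .
qed

lemma affine_refl_inner:
  assumes "fst \<beta> \<in> R"
  shows "fst (affine_refl \<beta> x) \<bullet> fst (affine_refl \<beta> y) = fst x \<bullet> fst y"
proof -
  let ?b = "fst \<beta>"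
  define n p q where "n = ?b \<bullet> ?b" and "p = fst x \<bullet> ?b" and "q = fst y \<bullet> ?b"
  have "n > 0" using inner_root_pos[OF assms] by (simp add: n_def)
  have "fst (affine_refl \<beta> x) \<bullet> fst (affine_refl \<beta> y)
      = (fst x - (2 * p / n) *\<^sub>R ?b) \<bullet> (fst y - (2 * q / n) *\<^sub>R ?b)"
    by (simp add: affine_refl_def inner_coroot n_def p_def q_def)
  also have "\<dots> = fst x \<bullet> fst y - (2 * q / n) * p - (2 * p / n) * (q - (2 * q / n) * n)"
    unfolding n_def p_def q_def by (simp add: inner_diff_left inner_diff_right inner_commute[of ?b "fst y"])
  also have "\<dots> = fst x \<bullet> fst y" using \<open>n > 0\<close> by (simp add: field_simps)
  finally show ?thesis .
qed

text \<open>The products \<nu> \<alpha> (\<gamma>, \<alpha>-coroot) and \<nu> \<gamma> (\<alpha>,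
  \<gamma>-coroot) both equal (\<alpha>, \<gamma>). So the level changes by an integral multiple of
  \<nu> \<gamma>, which is also \<nu> of the reflected root.\<close>

lemma affine_refl_Aroots:
  assumes "\<beta> \<in> Aroots" "x \<in> Aroots"
  shows "affine_refl \<beta> x \<in> Aroots"
proof -
  obtain \<alpha> k where b: "\<alpha> \<in> R" "\<beta> = (\<alpha>, \<nu> \<alpha> * of_int k)" using assms(1) by (cases \<beta>) (auto simp: Aroots_iff)
  obtain \<gamma> j where x: "\<gamma> \<in> R" "x = (\<gamma>, \<nu> \<gamma> * of_int j)" using assms(2) by (cases x) (auto simp: Aroots_iff)
  let ?c = "\<gamma> \<bullet> coroot \<alpha>"
  obtain d :: int where d: "\<alpha> \<bullet> coroot \<gamma> = of_int d" using inner_coroot_Ints[OF x(1) b(1)] by (metis Ints_cases)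
  have nu: "\<nu> (\<gamma> - ?c *\<^sub>R \<alpha>) = \<nu> \<gamma>" using norm_reflection[OF b(1), of \<gamma>] by (simp add: \<nu>_def)
  have "?c * \<nu> \<alpha> = \<nu> \<gamma> * of_int d"
    unfolding d[symmetric] using inner_root_pos[OF b(1)] inner_root_pos[OF x(1)]
    by (simp add: inner_coroot \<nu>_def inner_commute)
  then have "\<nu> \<gamma> * of_int j - ?c * (\<nu> \<alpha> * of_int k) = \<nu> \<gamma> * of_int (j - d * k)"
    by (simp add: algebra_simps)
  then have "affine_refl \<beta> x = (\<gamma> - ?c *\<^sub>R \<alpha>, \<nu> (\<gamma> - ?c *\<^sub>R \<alpha>) * of_int (j - d * k))"
    using nu b x by (simp add: affine_refl_def)
  then show ?thesis using reflection_in_R[OF b(1) x(1)] by (simp only: Aroots_iff) blast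
qed

lemma asimple_Apos: "i \<in> {0..DIM('a)} \<Longrightarrow> asimple i \<in> Apos"
proof (cases "i = 0")
  case True
  then show ?thesis using uminus_in_R[OF theta_in_R]
    by (auto simp: affine_simple_def Apos_iff Aroots_iff intro!: exI[of _ 1])
next
  case False
  assume "i \<in> {0..DIM('a)}"
  then have "a i \<in> Pos" using False simple_in_Pos[of i] by auto
  then show ?thesis using False Pos_in_R[of "a i"]
    by (auto simp: affine_simple_def Apos_iff Aroots_iff intro!: exI[of _ 0])
qed

lemma fst_asimple: "i \<in> {0..DIM('a)} \<Longrightarrow> fst (asimple i) \<in> R"
  by (rule asimple_Apos[THEN Apos_in_Aroots, THEN fst_Aroots])

lemma inj_asimple: "inj_on asimple {0..DIM('a)}"
proof (rule inj_onI)
  fix i j assume ij: "i \<in> {0..DIM('a)}" "j \<in> {0..DIM('a)}" "asimple i = asimple j"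
  show "i = j"
  proof (cases "i = 0 \<or> j = 0")
    case True
    have "snd (asimple i) = snd (asimple j)" using ij(3) by simp
    with True show ?thesis by (simp add: affine_simple_def split: if_splits)
  next
    case False
    then have "a i = a j" using ij(3) by (simp add: affine_simple_def)
    moreover have "i \<in> {1..DIM('a)}" "j \<in> {1..DIM('a)}" using False ij(1,2) by simp_all
    ultimately show ?thesis using inj_onD[OF inj_simple] by blast
  qed
qed

lemma simple_refl_Aroots: "i \<in> {0..DIM('a)} \<Longrightarrow> x \<in> Aroots \<Longrightarrow> simple_refl a \<theta> i x \<in> Aroots"
  by (rule affine_refl_Aroots[OF Apos_in_Aroots[OF asimple_Apos]])

text \<open>For i > 0 levels do not change, and level 0 is a statement about finite roots. For i = 0
  and \<beta> other than \<theta> and -\<theta>, the level drops by at most one unit \<nu> \<beta>,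
  so it cannot become negative; when it does drop, the new finite part has positive product with
  \<theta> and is itself positive. Only \<beta> = -\<theta> loses two levels, and level 1 is then
  the excluded root.\<close>

lemma simple_refl_Apos:
  assumes i: "i \<in> {0..DIM('a)}" and x: "x \<in> Apos" "x \<noteq> asimple i"
  shows "simple_refl a \<theta> i x \<in> Apos"
proof -
  obtain \<beta> t where bt: "x = (\<beta>, t)" by (cases x)
  have AR: "simple_refl a \<theta> i x \<in> Aroots" using simple_refl_Aroots[OF i] x Apos_in_Aroots by blast
  have xAR: "(\<beta>, t) \<in> Aroots" and t: "t > 0 \<or> t = 0 \<and> \<beta> \<in> Pos" using x bt by (auto simp: Apos_iff)
  have bR: "\<beta> \<in> R" using xAR by (simp add: Aroots_iff)
  show ?thesis
  proof (cases "i = 0")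
    case False
    then have i1: "i \<in> {1..DIM('a)}" using i by auto
    let ?c = "\<beta> \<bullet> coroot (a i)"
    have s: "simple_refl a \<theta> i x = (\<beta> - ?c *\<^sub>R a i, t)" using False bt by (simp add: affine_refl_def affine_simple_def)
    have "\<beta> - ?c *\<^sub>R a i \<in> Pos" if "t = 0" "\<beta> \<in> Pos"
      using Pos_minus_simple[OF i1 that(2)] reflection_in_R[OF simple_in_R[OF i1] bR] x(2) bt that False
      by (auto simp: affine_simple_def)
    then show ?thesis using t AR unfolding s by (auto simp: Apos_iff)
  next
    case True
    let ?p = "\<beta> \<bullet> \<theta>"
    have s: "simple_refl a \<theta> i x = (\<beta> - ?p *\<^sub>R \<theta>, t + ?p)" using True bt by (simp add: affine_refl_def affine_simple_def coroot_theta)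
    consider "\<beta> = \<theta>" | "\<beta> = - \<theta>" | "\<theta> \<bullet> coroot \<beta> = -1" "\<beta> \<noteq> \<theta>" "\<beta> \<noteq> - \<theta>" | "\<theta> \<bullet> coroot \<beta> = 0" | "\<theta> \<bullet> coroot \<beta> = 1"
      using inner_theta_coroot[OF bR] by auto
    moreover have pc: "?p = \<nu> \<beta> * (\<theta> \<bullet> coroot \<beta>)"
      using inner_root_pos[OF bR] by (simp add: inner_coroot \<nu>_def inner_commute)
    ultimately show ?thesis
    proof cases
      case 1 then show ?thesis using t AR unfolding s by (auto simp: Apos_iff theta_norm)
    next
      case 2
      then have p2: "?p = - 2" using theta_norm by simp
      have "t \<noteq> 1" using 2 x(2) bt True by (auto simp: affine_simple_def)
      moreover obtain j :: int where j: "t = of_int j" using xAR 2 by (auto simp: Aroots_iff)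
      moreover have "t > 0" using t 2 theta_Pos not_Pos_uminus by auto
      ultimately have "j \<ge> 2" by simp
      then have "t \<ge> 2" using j by simp
      moreover have "\<beta> - ?p *\<^sub>R \<theta> = \<theta>" unfolding p2 using 2 by (simp add: scaleR_2)
      ultimately show ?thesis using AR theta_Pos p2 unfolding s by (auto simp: Apos_iff)
    next
      case 3
      then have p: "?p = - \<nu> \<beta>" using pc by simp
      have "\<nu> \<beta> > 0" using nu_ge_1[OF bR] by simp
      then have "\<beta> \<notin> Pos" using p inner_theta_Pos[of \<beta>] by (auto simp: inner_commute)
      then have "t \<ge> \<nu> \<beta>" using t Aroots_level_ge[OF xAR] by auto
      moreover have "\<beta> - ?p *\<^sub>R \<theta> \<in> Pos"
      proof (rule Pos_if_inner_theta)
        show "\<beta> - ?p *\<^sub>R \<theta> \<in> R" using reflection_in_R[OF theta_in_R bR] by (simp add: coroot_theta)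
        have "\<theta> \<bullet> (\<beta> - ?p *\<^sub>R \<theta>) = \<theta> \<bullet> \<beta> - ?p * 2" by (simp add: inner_diff_right theta_norm)
        then show "\<theta> \<bullet> (\<beta> - ?p *\<^sub>R \<theta>) > 0" using p \<open>\<nu> \<beta> > 0\<close> inner_commute[of \<theta> \<beta>] by simp
      qed
      ultimately show ?thesis using AR p unfolding s by (auto simp: Apos_iff)
    next
      case 4 then show ?thesis using x(1) bt pc unfolding s by simp
    next
      case 5 then show ?thesis using AR t pc nu_ge_1[OF bR] unfolding s by (auto simp: Apos_iff)
    qed
  qed
qed

lemma simple_refl_asimple: "i \<in> {0..DIM('a)} \<Longrightarrow> simple_refl a \<theta> i (asimple i) = - asimple i"
  by (simp add: affine_refl_self fst_asimple)

lemma simple_refl_invol [simp]: "i \<in> {0..DIM('a)} \<Longrightarrow> simple_refl a \<theta> i (simple_refl a \<theta> i x) = x"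
  by (simp add: affine_refl_involution fst_asimple)

lemma not_Apos_uminus: "x \<in> Apos \<Longrightarrow> - x \<notin> Apos"
  using aht_pos[of x] aht_pos[of "- x"] by (auto simp: aht_simps)

lemma zero_notin_Apos: "0 \<notin> Apos"
  using aht_pos[of 0] linear_0[OF linear_hgt] by (auto simp: aht_def)

text \<open>Neither summand could be \<open>asimple i\<close>, as the other would vanish. So the
  reflection keeps both summands positive, and with them their sum, whereas it negates
  \<open>asimple i\<close>.\<close>

lemma asimple_not_sum:
  assumes "i \<in> {0..DIM('a)}" "x \<in> Apos" "y \<in> Apos" shows "asimple i \<noteq> x + y"
proof
  assume e: "asimple i = x + y"
  have "x \<noteq> asimple i" "y \<noteq> asimple i" using e assms zero_notin_Apos by auto
  then have "aht (simple_refl a \<theta> i x) > 0" "aht (simple_refl a \<theta> i y) > 0"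
    using simple_refl_Apos aht_pos assms by auto
  then have "aht (simple_refl a \<theta> i (asimple i)) > 0"
    unfolding e by (simp add: linear_add[OF linear_affine_refl] aht_simps)
  then show False using simple_refl_asimple[OF assms(1)] aht_pos[OF asimple_Apos[OF assms(1)]] by (simp add: aht_simps)
qed

section \<open>Splitting positive affine roots\<close>

lemma Pos_split:
  assumes "\<beta> \<in> Pos" "\<beta> \<notin> a ` {1..DIM('a)}"
  shows "\<exists>x\<in>Apos. \<exists>y\<in>Apos. (\<beta>, 0) = x + y"
proof -
  obtain i where "i \<in> {1..DIM('a)}" "\<beta> - a i \<in> Pos" using Pos_nonsimple_split[OF assms] by blast
  then have "(\<beta> - a i, 0) \<in> Apos" "(a i, 0) \<in> Apos"
    using simple_in_Pos Pos_in_R by (auto simp: Apos_iff Aroots_iff intro!: exI[of _ 0])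
  then show ?thesis by (intro bexI[of _ "(\<beta> - a i, 0)"] bexI[of _ "(a i, 0)"]) auto
qed

text \<open>The root \<gamma> is placed at level 0 and the whole level t goes to \<alpha> -
  \<gamma>, where it is admissible by the divisibility in \<open>root_diff\<close>.\<close>

lemma split_by_Pos:
  assumes x: "(\<alpha>, t) \<in> Aroots" "t > 0" and g: "\<gamma> \<in> Pos" "\<gamma> \<noteq> \<alpha>" "\<alpha> \<bullet> \<gamma> > 0"
  shows "\<exists>x\<in>Apos. \<exists>y\<in>Apos. (\<alpha>, t) = x + y"
proof -
  obtain j :: int where j: "\<alpha> \<in> R" "t = \<nu> \<alpha> * of_int j" using x by (auto simp: Aroots_iff)
  note d = root_diff[OF j(1) Pos_in_R[OF g(1)] g(2)[symmetric] g(3)]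
  obtain k :: int where "\<nu> \<alpha> = of_int k * \<nu> (\<alpha> - \<gamma>)" using d by blast
  then have "t = \<nu> (\<alpha> - \<gamma>) * of_int (k * j)" using j by simp
  then have "(\<alpha> - \<gamma>, t) \<in> Apos" using d(1) x(2) unfolding Apos_iff Aroots_iff by blast
  moreover have "(\<gamma>, 0) \<in> Apos" using g Pos_in_R by (auto simp: Apos_iff Aroots_iff intro!: exI[of _ 0])
  ultimately show ?thesis by (intro bexI[of _ "(\<alpha> - \<gamma>, t)"] bexI[of _ "(\<gamma>, 0)"]) auto
qed

lemma Apos_short: "\<alpha> \<in> R \<Longrightarrow> \<nu> \<alpha> = 1 \<Longrightarrow> t > 0 \<or> t = 0 \<and> \<alpha> \<in> Pos \<Longrightarrow> t = of_int j \<Longrightarrow> (\<alpha>, t) \<in> Apos"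
  by (auto simp: Apos_iff Aroots_iff)

text \<open>The summand split off is [-\<theta>, 1]. The rest \<alpha> + \<theta> is short, so the
  integer t - 1 is one of its levels. If t = 1, then \<nu> \<alpha> = 1 and \<alpha> + \<theta> has
  product 1 with \<theta>, hence is positive at level 0.\<close>

lemma split_by_theta:
  assumes x: "(\<alpha>, t) \<in> Aroots" "t > 0" and g: "\<alpha> \<noteq> - \<theta>" "\<theta> \<bullet> \<alpha> < 0"
  shows "\<exists>x\<in>Apos. \<exists>y\<in>Apos. (\<alpha>, t) = x + y"
proof -
  obtain j :: int where j: "\<alpha> \<in> R" "t = \<nu> \<alpha> * of_int j" using x by (auto simp: Aroots_iff)
  have "- \<alpha> \<noteq> \<theta>" "\<theta> \<bullet> - \<alpha> > 0" using g by auto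
  note d = inner_theta_pos_eq[OF uminus_in_R[OF j(1)] this]
  obtain m :: int where m: "m \<ge> 1" "\<nu> \<alpha> = of_int m" using d(2) by auto
  have 1: "\<alpha> + \<theta> \<in> R" using uminus_in_R[OF d(3)] by (simp add: add.commute)
  have "(\<alpha> + \<theta>) \<bullet> (\<alpha> + \<theta>) = (- \<alpha> - \<theta>) \<bullet> (- \<alpha> - \<theta>)" by (simp add: algebra_simps inner_commute)
  then have 2: "\<nu> (\<alpha> + \<theta>) = 1" using d(4) by (simp add: \<nu>_def)
  have t: "t = of_int (m * j)" using m j by simp
  with x(2) have mj: "m * j \<ge> 1" by linarith
  have tm: "t \<ge> of_int m" using Aroots_level_ge[OF x] m by simp
  have "t - 1 = of_int (m * j - 1)" using t by simp
  moreover have "t - 1 > 0 \<or> t - 1 = 0 \<and> \<alpha> + \<theta> \<in> Pos"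
  proof (cases "t = 1")
    case True
    then have "m = 1" using tm m(1) by simp
    then have "\<theta> \<bullet> (\<alpha> + \<theta>) > 0" using d(1) m(2) by (simp add: inner_add_right theta_norm)
    then show ?thesis using Pos_if_inner_theta[OF 1] True by simp
  qed (use t mj in linarith)
  ultimately have "(\<alpha> + \<theta>, t - 1) \<in> Apos" using Apos_short[OF 1 2] by blast
  moreover have "(- \<theta>, 1) \<in> Apos" using uminus_in_R[OF theta_in_R] by (intro Apos_short[of _ _ 1]) auto
  ultimately show ?thesis by (intro bexI[of _ "(\<alpha> + \<theta>, t - 1)"] bexI[of _ "(- \<theta>, 1)"]) auto
qed

text \<open>A short root \<epsilon> other than \<theta> with (\<theta>, \<epsilon>) > 0 gives
  [-\<theta>, j] = [-\<epsilon>, 1] + [\<epsilon> - \<theta>, j - 1]. A neighbour \<gamma> of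
  \<theta> is such a root if \<nu> \<gamma> = 1, and \<gamma> - \<theta> is one if \<nu> \<gamma> is
  at least 3. If \<nu> \<gamma> = 2, then \<epsilon> = \<gamma> - \<theta> is orthogonal to \<theta>
  and both \<theta> + \<epsilon> and \<theta> - \<epsilon> are roots with \<nu> = 2. Choosing the
  sign of \<epsilon> so that it is positive gives [-\<theta>, j] = [-(\<theta> + \<epsilon>), 2] +
  [\<epsilon>, j - 2], which covers j = 2 as well.\<close>

lemma split_theta_level:
  assumes rank: "DIM('a) \<ge> 2" and j: "j \<ge> 2"
  shows "\<exists>x\<in>Apos. \<exists>y\<in>Apos. (- \<theta>, real_of_int j) = x + y"
proof -
  obtain \<gamma> where g: "\<gamma> \<in> R" "\<gamma> \<noteq> \<theta>" "\<gamma> \<noteq> - \<theta>" "\<gamma> \<bullet> \<theta> > 0"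
    using exists_neighbour[OF theta_in_R rank] by blast
  then have gt: "\<theta> \<bullet> \<gamma> > 0" by (simp add: inner_commute)
  note d = inner_theta_pos_eq[OF g(1,2) gt]
  have short: ?thesis if e: "\<epsilon> \<in> R" "\<nu> \<epsilon> = 1" "\<epsilon> \<noteq> \<theta>" "\<theta> \<bullet> \<epsilon> > 0" for \<epsilon>
  proof -
    note d' = inner_theta_pos_eq[OF e(1,3,4)]
    have "(- \<epsilon>, 1) \<in> Apos" using uminus_in_R[OF e(1)] e(2) by (intro Apos_short[of _ _ 1]) auto
    moreover have "(\<epsilon> - \<theta>, real_of_int (j - 1)) \<in> Apos"
      using d'(3,4) j by (intro Apos_short[of _ _ "j - 1"]) (auto simp: \<nu>_def)
    ultimately show ?thesis by (intro bexI[of _ "(- \<epsilon>, 1)"] bexI[of _ "(\<epsilon> - \<theta>, real_of_int (j - 1))"]) auto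
  qed
  obtain m :: int where m: "m \<ge> 1" "\<nu> \<gamma> = of_int m" using d(2) by auto
  let ?\<epsilon> = "\<gamma> - \<theta>"
  have nue: "\<nu> ?\<epsilon> = 1" using d(4) by (simp add: \<nu>_def)
  have te: "\<theta> \<bullet> ?\<epsilon> = of_int (m - 2)" using d(1) m by (simp add: inner_diff_right theta_norm)
  consider "m = 1" | "m = 2" | "m \<ge> 3" using m by linarith
  then show ?thesis
  proof cases
    case 1 then show ?thesis using short[OF g(1) _ g(2) gt] m by simp
  next
    case 3
    have "?\<epsilon> \<noteq> \<theta>"
    proof
      assume "?\<epsilon> = \<theta>"
      then have "\<gamma> = 2 *\<^sub>R \<theta>" by (simp add: algebra_simps scaleR_2)
      then show False using scaleR_in_R[OF theta_in_R, of 2] g(1) by simp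
    qed
    moreover have "\<theta> \<bullet> ?\<epsilon> > 0" using te 3 by simp
    ultimately show ?thesis using short[OF d(3) nue] by blast
  next
    case 2
    have two: ?thesis if e: "\<epsilon> \<in> Pos" "\<nu> \<epsilon> = 1" "\<theta> + \<epsilon> \<in> R" "\<nu> (\<theta> + \<epsilon>) = 2" for \<epsilon>
    proof -
      have "(- (\<theta> + \<epsilon>), 2) \<in> Apos" using uminus_in_R[OF e(3)] e(4) nu_uminus[of "\<theta> + \<epsilon>"]
        by (simp only: Apos_iff Aroots_iff) (auto intro!: exI[of _ 1])
      moreover have "(\<epsilon>, real_of_int (j - 2)) \<in> Apos"
        using e j Pos_in_R by (intro Apos_short[of _ _ "j - 2"]) auto
      ultimately show ?thesis
        by (intro bexI[of _ "(- (\<theta> + \<epsilon>), 2)"] bexI[of _ "(\<epsilon>, real_of_int (j - 2))"]) auto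
    qed
    have ee: "?\<epsilon> \<bullet> ?\<epsilon> = 2" using nue by (simp add: \<nu>_def)
    have "\<gamma> \<bullet> ?\<epsilon> = 2" using ee te 2 by (simp add: inner_diff_left inner_diff_right inner_commute)
    then have "\<gamma> \<bullet> coroot ?\<epsilon> = 2" using ee by (simp add: inner_coroot)
    then have r: "\<gamma> - 2 *\<^sub>R ?\<epsilon> \<in> R" "(\<gamma> - 2 *\<^sub>R ?\<epsilon>) \<bullet> (\<gamma> - 2 *\<^sub>R ?\<epsilon>) = \<gamma> \<bullet> \<gamma>"
      using reflection_in_R[OF d(3) g(1)] norm_reflection[OF d(3), of \<gamma>] by simp_all
    have r': "\<gamma> - 2 *\<^sub>R ?\<epsilon> = \<theta> + - ?\<epsilon>" by (simp add: algebra_simps scaleR_2)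
    have r2: "\<theta> + - ?\<epsilon> \<in> R" "\<nu> (\<theta> + - ?\<epsilon>) = 2" using r m 2 unfolding r' by (simp_all only: \<nu>_def of_int_numeral)
    have nue': "\<nu> (- ?\<epsilon>) = 1" using nue by (simp only: nu_uminus)
    from Pos_or_neg[OF d(3)] show ?thesis
    proof
      assume "?\<epsilon> \<in> Pos" then show ?thesis using two[OF _ nue] g m 2 by simp
    next
      assume "- ?\<epsilon> \<in> Pos" then show ?thesis using two[OF _ nue' r2] by blast
    qed
  qed
qed

text \<open>Any positive \<gamma> with (\<alpha>, \<gamma>) > 0 could be split off at level 0, so
  -\<alpha> is dominant. By \<open>dominant_inner_theta\<close> it pairs positively with \<theta>,
  and then [-\<theta>, 1] could be split off unless \<alpha> = -\<theta>.\<close>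

lemma Apos_antidominant:
  assumes x: "(\<alpha>, t) \<in> Apos" "\<alpha> \<notin> Pos" "\<not> (\<exists>x\<in>Apos. \<exists>y\<in>Apos. (\<alpha>, t) = x + y)" "(\<alpha>, t) \<notin> asimple ` {0..DIM('a)}"
  shows "\<alpha> = - \<theta> \<and> (\<exists>j::int. t = of_int j \<and> j \<ge> 2)"
proof -
  have t: "(\<alpha>, t) \<in> Aroots" "t > 0" using x by (auto simp: Apos_iff)
  then have aR: "\<alpha> \<in> R" by (simp add: Aroots_iff)
  have "- \<alpha> \<bullet> \<gamma> \<ge> 0" if "\<gamma> \<in> Pos" for \<gamma>
    using split_by_Pos[OF t that] x(2,3) that by (metis inner_minus_left neg_0_le_iff_le not_le)
  from dominant_inner_theta[OF uminus_in_R[OF aR] this] have "\<theta> \<bullet> \<alpha> < 0" by simp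
  then have a: "\<alpha> = - \<theta>" using split_by_theta[OF t] x(3) by blast
  then obtain j :: int where j: "t = of_int j" using t by (auto simp: Aroots_iff)
  have "t \<noteq> 1" using x(4) a by (auto simp: affine_simple_def image_iff)
  then show ?thesis using a j t(2) by auto
qed

text \<open>A positive root other than \<alpha> with positive product with \<alpha> is wanted. If
  the neighbour \<beta> is negative, the negative of its reflection in \<alpha> has the same product
  with \<alpha> and positive height.\<close>

lemma Pos_level_split:
  assumes x: "(\<alpha>, t) \<in> Aroots" "t > 0" "\<alpha> \<in> Pos" and rank: "DIM('a) \<ge> 2"
  shows "\<exists>x\<in>Apos. \<exists>y\<in>Apos. (\<alpha>, t) = x + y"
proof -
  have aR: "\<alpha> \<in> R" using x Pos_in_R by blast
  obtain \<beta> where b: "\<beta> \<in> R" "\<beta> \<noteq> \<alpha>" "\<beta> \<noteq> - \<alpha>" "\<beta> \<bullet> \<alpha> > 0" using exists_neighbour[OF aR rank] by blast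
  show ?thesis
  proof (cases "\<beta> \<in> Pos")
    case True then show ?thesis using split_by_Pos[OF x(1,2) True b(2)] b(4) by (simp add: inner_commute)
  next
    case False
    then have nb: "- \<beta> \<in> Pos" using Pos_or_neg b by blast
    let ?c = "\<beta> \<bullet> coroot \<alpha>"
    let ?\<gamma> = "- (\<beta> - ?c *\<^sub>R \<alpha>)"
    have ap: "\<alpha> \<bullet> \<alpha> > 0" using inner_root_pos[OF aR] .
    have c: "?c > 0" using b(4) ap by (simp add: inner_coroot)
    have gR: "?\<gamma> \<in> R" using reflection_in_R[OF aR b(1)] uminus_in_R by blast
    have "hgt ?\<gamma> = hgt (- \<beta>) + ?c * hgt \<alpha>"
      by (simp add: linear_diff[OF linear_hgt] linear_neg[OF linear_hgt] linear_scale[OF linear_hgt])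
    also have "\<dots> > 0" using hgt_pos[OF nb] hgt_pos[OF x(3)] c by (simp add: add_pos_pos)
    finally have hg: "hgt ?\<gamma> > 0" .
    have "?\<gamma> \<in> Pos"
    proof (rule ccontr)
      assume "?\<gamma> \<notin> Pos"
      then have "- ?\<gamma> \<in> Pos" using Pos_or_neg[OF gR] by blast
      then show False using hgt_pos[of "- ?\<gamma>"] hg linear_neg[OF linear_hgt, of ?\<gamma>] by simp
    qed
    moreover have "?\<gamma> \<noteq> \<alpha>"
    proof
      assume "?\<gamma> = \<alpha>"
      then have "\<beta> = (?c - 1) *\<^sub>R \<alpha>" by (simp add: algebra_simps)
      then show False using scaleR_in_R[OF aR, of "?c - 1"] b(1-3) by auto
    qed
    moreover have "\<alpha> \<bullet> ?\<gamma> = \<alpha> \<bullet> \<beta>"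
      using ap by (simp add: inner_diff_right inner_coroot inner_commute)
    then have "\<alpha> \<bullet> ?\<gamma> > 0" using b(4) by (simp add: inner_commute)
    ultimately show ?thesis using split_by_Pos[OF x(1,2)] by blast
  qed
qed

lemma Apos_level_0:
  assumes "(\<alpha>, 0) \<in> Apos" "(\<alpha>, 0) \<notin> asimple ` {0..DIM('a)}"
  shows "\<exists>x\<in>Apos. \<exists>y\<in>Apos. (\<alpha>, 0) = x + y"
proof (rule Pos_split)
  show "\<alpha> \<in> Pos" using assms by (simp add: Apos_iff)
  show "\<alpha> \<notin> a ` {1..DIM('a)}"
  proof
    assume "\<alpha> \<in> a ` {1..DIM('a)}"
    then obtain i where "i \<in> {1..DIM('a)}" "\<alpha> = a i" by blast
    then have "(\<alpha>, 0) = asimple i" "i \<in> {0..DIM('a)}" by (auto simp: affine_simple_def)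
    with assms(2) show False by blast
  qed
qed

text \<open>In rank one this fails for all but the simple roots, whence the weak form that follows it.\<close>

lemma Apos_decompose:
  assumes x: "x \<in> Apos" and rank: "DIM('a) \<ge> 2"
  shows "x \<in> asimple ` {0..DIM('a)} \<or> (\<exists>y\<in>Apos. \<exists>z\<in>Apos. x = y + z)"
proof (rule ccontr)
  assume n: "\<not> ?thesis"
  obtain \<alpha> t where at: "x = (\<alpha>, t)" by (cases x)
  have "t \<noteq> 0" using Apos_level_0[of \<alpha>] n x at by auto
  then have t: "(\<alpha>, t) \<in> Aroots" "t > 0" using x at by (auto simp: Apos_iff)
  have "\<alpha> \<notin> Pos" using Pos_level_split[OF t _ rank] n at by blast
  then obtain j :: int where "\<alpha> = - \<theta>" "t = of_int j" "j \<ge> 2" using Apos_antidominant[of \<alpha> t] x n at by blast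
  then show False using split_theta_level[OF rank] n at by blast
qed

lemma Apos_decompose_weak:
  assumes x: "x \<in> Apos"
  shows "x \<in> asimple ` {0..DIM('a)} \<or> (\<exists>y\<in>Apos. \<exists>z\<in>Apos. x = y + z) \<or> (\<exists>y\<in>Apos. \<exists>t>0. x = y + (0, t))"
proof (rule ccontr)
  assume n: "\<not> ?thesis"
  obtain \<alpha> t where at: "x = (\<alpha>, t)" by (cases x)
  have "t \<noteq> 0" using Apos_level_0[of \<alpha>] n x at by auto
  then have t: "(\<alpha>, t) \<in> Aroots" "t > 0" using x at by (auto simp: Apos_iff)
  have "\<alpha> \<notin> Pos"
  proof
    assume a: "\<alpha> \<in> Pos"
    then have "(\<alpha>, 0) \<in> Apos" using Pos_in_R by (auto simp: Apos_iff Aroots_iff intro!: exI[of _ 0])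
    moreover have "x = (\<alpha>, 0) + (0, t)" using at by simp
    ultimately show False using n t(2) by blast
  qed
  then obtain j :: int where j: "\<alpha> = - \<theta>" "t = of_int j" "j \<ge> 2" using Apos_antidominant[of \<alpha> t] x n at by blast
  have "(- \<theta>, real_of_int (j - 1)) \<in> Apos" using uminus_in_R[OF theta_in_R] j by (intro Apos_short[of _ _ "j - 1"]) auto
  moreover have "x = (- \<theta>, real_of_int (j - 1)) + (0, 1)" using at j by simp
  ultimately show False using n zero_less_one by blast
qed

subsection \<open>Words and inversion sets\<close>

abbreviation "srefl \<equiv> simple_refl a \<theta>"
abbreviation "word \<equiv> word_prod a \<theta>"

section \<open>Sign changes of roots under a linear map\<close>

text \<open>Each property has its use for \<lambda>(w): stability of the roots gives every image a
  sign, linearity the closure under positive combinations of \<lambda>(w) and of its complement, and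
  the fixed vectors (0, t) the closure under lowering levels.\<close>

definition affine_aut :: "('a \<times> real \<Rightarrow> 'a \<times> real) \<Rightarrow> bool" where
  "affine_aut w \<longleftrightarrow> linear w \<and> (\<forall>x\<in>Aroots. w x \<in> Aroots) \<and> (\<forall>t. w (0, t) = (0, t))"

lemma affine_aut_word: "set us \<subseteq> {0..DIM('a)} \<Longrightarrow> affine_aut (word us)"
proof (induction us)
  case Nil
  then show ?case using linear_id by (simp add: affine_aut_def id_def)
next
  case (Cons i us)
  then have "linear (word us)" "affine_aut (word us)" and i: "i \<in> {0..DIM('a)}" by (auto simp: affine_aut_def)
  moreover from this(1) have "linear (word us \<circ> srefl i)" by (rule linear_compose[OF linear_affine_refl])
  ultimately show ?case using simple_refl_Aroots[OF i] by (simp add: affine_aut_def comp_def)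
qed

lemma lambda_iff:
  assumes "affine_aut w"
  shows "x \<in> lambda_set R a w \<longleftrightarrow> x \<in> Apos \<and> aht (w x) < 0"
proof (cases "x \<in> Apos")
  case True
  then have "w x \<in> Aroots" using assms Apos_in_Aroots by (auto simp: affine_aut_def)
  then show ?thesis using True by (simp add: lambda_set_def neg_iff_aht)
qed (simp add: lambda_set_def)

lemma lambda_cone:
  assumes w: "affine_aut w" and xy: "x \<in> lambda_set R a w" "y \<in> lambda_set R a w"
    and uv: "u > 0" "v > 0" "u *\<^sub>R x + v *\<^sub>R y \<in> Apos"
  shows "u *\<^sub>R x + v *\<^sub>R y \<in> lambda_set R a w"
proof -
  have l: "linear w" using w by (simp add: affine_aut_def)
  have "aht (w (u *\<^sub>R x + v *\<^sub>R y)) = u * aht (w x) + v * aht (w y)"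
    by (simp add: linear_add[OF l] linear_scale[OF l] aht_simps)
  also have "\<dots> < 0" using xy uv by (simp add: lambda_iff[OF w] add_neg_neg mult_pos_neg)
  finally show ?thesis using uv by (simp add: lambda_iff[OF w])
qed

lemma lambda_cocone:
  assumes w: "affine_aut w" and x: "u *\<^sub>R x + v *\<^sub>R y \<in> lambda_set R a w"
    and uv: "u > 0" "v > 0" "x \<in> Apos" "y \<in> Apos"
  shows "x \<in> lambda_set R a w \<or> y \<in> lambda_set R a w"
proof -
  have l: "linear w" using w by (simp add: affine_aut_def)
  have "aht (w (u *\<^sub>R x + v *\<^sub>R y)) = u * aht (w x) + v * aht (w y)"
    by (simp add: linear_add[OF l] linear_scale[OF l] aht_simps)
  moreover have "aht (w (u *\<^sub>R x + v *\<^sub>R y)) < 0" using x by (simp add: lambda_iff[OF w])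
  moreover have "0 \<le> u * aht (w x) + v * aht (w y)" if "aht (w x) \<ge> 0" "aht (w y) \<ge> 0"
    using that uv by simp
  ultimately show ?thesis using uv by (fastforce simp: lambda_iff[OF w])
qed

lemma lambda_shift:
  assumes w: "affine_aut w" and x: "y + (0, t) \<in> lambda_set R a w" "y \<in> Apos" "t > 0"
  shows "y \<in> lambda_set R a w"
proof -
  have l: "linear w" using w by (simp add: affine_aut_def)
  have "aht (w (y + (0, t))) = aht (w y) + bnd * t"
    using w by (simp add: linear_add[OF l] aht_simps affine_aut_def)
  moreover have "bnd * t > 0" using bnd_pos x by simp
  ultimately show ?thesis using x by (simp add: lambda_iff[OF w])
qed

lemma lambda_set_subset: "lambda_set R a w \<subseteq> Apos"
  by (auto simp: lambda_set_def)

lemma lambda_comp_iff: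
  assumes "i \<in> {0..DIM('a)}" "affine_aut w" "x \<in> Apos" "x \<noteq> asimple i"
  shows "x \<in> lambda_set R a (w \<circ> srefl i) \<longleftrightarrow> srefl i x \<in> lambda_set R a w"
  using simple_refl_Apos[OF assms(1,3,4)] assms(3) by (simp add: lambda_set_def)

lemma srefl_Apos_ne:
  assumes "i \<in> {0..DIM('a)}" "x \<in> Apos" shows "srefl i x \<noteq> asimple i"
proof
  assume "srefl i x = asimple i"
  then have "x = srefl i (asimple i)" using simple_refl_invol[OF assms(1)] by metis
  then show False using simple_refl_asimple[OF assms(1)] asimple_Apos[OF assms(1)] not_Apos_uminus assms(2) by metis
qed

text \<open>The reflection permutes the positive roots other than \<open>asimple i\<close> and
  negates that one. This is the set version of the recursion \<open>lambda_seq_Cons\<close>.\<close>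

lemma lambda_comp:
  assumes i: "i \<in> {0..DIM('a)}" and w: "affine_aut w" and n: "asimple i \<notin> lambda_set R a w"
  shows "lambda_set R a (w \<circ> srefl i) = insert (asimple i) (srefl i ` lambda_set R a w)"
proof -
  have l: "linear w" using w by (simp add: affine_aut_def)
  have wAR: "w (asimple i) \<in> Aroots" using w asimple_Apos[OF i] Apos_in_Aroots by (auto simp: affine_aut_def)
  have "asimple i \<in> lambda_set R a (w \<circ> srefl i)"
  proof -
    have "\<not> aht (w (asimple i)) < 0" using n asimple_Apos[OF i] by (simp add: lambda_iff[OF w])
    then have "w (asimple i) \<in> Apos" using Apos_or_neg[OF wAR] aht_pos[of "- w (asimple i)"] by (auto simp: aht_simps)
    then have "w (srefl i (asimple i)) \<in> affine_neg R a"
      using simple_refl_asimple[OF i] by (simp add: affine_neg_def linear_neg[OF l])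
    then show ?thesis using asimple_Apos[OF i] by (simp add: lambda_set_def)
  qed
  moreover have "x \<in> lambda_set R a (w \<circ> srefl i) \<longleftrightarrow> x \<in> srefl i ` lambda_set R a w" if "x \<noteq> asimple i" for x
  proof
    assume "x \<in> lambda_set R a (w \<circ> srefl i)"
    moreover from this have "x \<in> Apos" using lambda_set_subset by blast
    ultimately have "srefl i x \<in> lambda_set R a w" using lambda_comp_iff[OF i w _ that] by blast
    then have "srefl i (srefl i x) \<in> srefl i ` lambda_set R a w" by (rule imageI)
    then show "x \<in> srefl i ` lambda_set R a w" using i by simp
  next
    assume "x \<in> srefl i ` lambda_set R a w"
    then obtain y where y: "x = srefl i y" "y \<in> lambda_set R a w" by blast
    then have "y \<in> Apos" "y \<noteq> asimple i" using lambda_set_subset n by auto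
    then have "x \<in> Apos" using simple_refl_Apos[OF i] y by blast
    then show "x \<in> lambda_set R a (w \<circ> srefl i)" using lambda_comp_iff[OF i w _ that] y i by simp
  qed
  ultimately have "x \<in> lambda_set R a (w \<circ> srefl i) \<longleftrightarrow> x \<in> insert (asimple i) (srefl i ` lambda_set R a w)" for x
    by (cases "x = asimple i") simp_all
  then show ?thesis by blast
qed

section \<open>Words and the exchange condition\<close>

lemma word_append: "word (xs @ ys) = word ys \<circ> word xs"
  by (induction xs) (auto simp: comp_assoc)

lemma word_rev: "set us \<subseteq> {0..DIM('a)} \<Longrightarrow> word (rev us) (word us x) = x"
  by (induction us arbitrary: x) (auto simp: word_append)

lemma word_rev': "set us \<subseteq> {0..DIM('a)} \<Longrightarrow> word us (word (rev us) x) = x"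
  using word_rev[of "rev us"] by simp

text \<open>A word applies its first letter first, whereas \<open>foldr\<close> applies it last;
  hence the reversal.\<close>

lemma foldr_srefl: "foldr srefl us = word (rev us)"
  by (induction us) (auto simp: word_append)

lemma lambda_seq_Nil [simp]: "lambda_seq a \<theta> [] = []"
  by (simp add: lambda_seq_def)

text \<open>In every entry after the first, the reflection of the first letter is the outermost one.
  The inductions on words below strip it off by this recursion.\<close>

lemma lambda_seq_Cons [simp]: "lambda_seq a \<theta> (i # us) = asimple i # map (srefl i) (lambda_seq a \<theta> us)"
proof -
  have "[0..<length (i # us)] = 0 # map Suc [0..<length us]"
    by (simp add: map_Suc_upt upt_conv_Cons del: upt_Suc)
  then show ?thesis by (simp add: lambda_seq_def comp_def del: upt_Suc)
qed

lemma length_lambda_seq [simp]: "length (lambda_seq a \<theta> us) = length us"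
  by (simp add: lambda_seq_def)

lemma take_lambda_seq: "take k (lambda_seq a \<theta> us) = lambda_seq a \<theta> (take k us)"
proof (induction us arbitrary: k)
  case (Cons i us) then show ?case by (cases k) (simp_all add: take_map)
qed simp

lemma affine_weyl_iff: "w \<in> affine_weyl_group a \<theta> \<longleftrightarrow> (\<exists>us. set us \<subseteq> {0..DIM('a)} \<and> w = word us)"
proof
  assume "w \<in> affine_weyl_group a \<theta>"
  then show "\<exists>us. set us \<subseteq> {0..DIM('a)} \<and> w = word us"
    unfolding affine_weyl_group_def
  proof induction
    case id
    show ?case by (intro exI[of _ "[]"]) simp
  next
    case (comp s w)
    then obtain i us where "s = srefl i" "i \<in> {0..DIM('a)}" "set us \<subseteq> {0..DIM('a)}" "w = word us" by blast
    then show ?case by (intro exI[of _ "us @ [i]"]) (simp add: word_append)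
  qed
next
  assume "\<exists>us. set us \<subseteq> {0..DIM('a)} \<and> w = word us"
  then obtain us where "set us \<subseteq> {0..DIM('a)}" "w = word us" by blast
  then show "w \<in> affine_weyl_group a \<theta>"
  proof (induction us arbitrary: w rule: rev_induct)
    case Nil
    then show ?case by (simp only: word_prod.simps affine_weyl_group_def generated.id)
  next
    case (snoc i us)
    then have "srefl i \<circ> word us \<in> affine_weyl_group a \<theta>"
      unfolding affine_weyl_group_def by (intro generated.comp) auto
    moreover have "w = srefl i \<circ> word us" using snoc.prems(2) by (simp add: word_append comp_def)
    ultimately show ?case by (simp only:)
  qed
qed

lemma word_in_weyl: "set us \<subseteq> {0..DIM('a)} \<Longrightarrow> word us \<in> affine_weyl_group a \<theta>"
  using affine_weyl_iff by blast

lemma conj_affine_refl: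
  assumes "linear g" "\<And>x y. fst (g x) \<bullet> fst (g y) = fst x \<bullet> fst y"
  shows "affine_refl (g \<beta>) (g x) = g (affine_refl \<beta> x)"
  by (simp add: affine_refl_def coroot_def assms(2) linear_diff[OF assms(1)] linear_scale[OF assms(1)])

lemma word_inner: "set us \<subseteq> {0..DIM('a)} \<Longrightarrow> fst (word us x) \<bullet> fst (word us y) = fst x \<bullet> fst y"
  by (induction us arbitrary: x y) (simp_all add: affine_refl_inner fst_asimple)

text \<open>Under one simple reflection only the corresponding simple root changes from positive to
  negative, so a root made negative by the word is listed at a letter where this happens.\<close>

lemma lambda_subset_seq:
  "set us \<subseteq> {0..DIM('a)} \<Longrightarrow> lambda_set R a (word us) \<subseteq> set (lambda_seq a \<theta> us)"
proof (induction us)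
  case Nil
  then show ?case using aht_pos lambda_iff[OF affine_aut_word[of "[]"]] by fastforce
next
  case (Cons i us)
  then have i: "i \<in> {0..DIM('a)}" and us: "set us \<subseteq> {0..DIM('a)}" by auto
  show ?case
  proof
    fix x assume x: "x \<in> lambda_set R a (word (i # us))"
    show "x \<in> set (lambda_seq a \<theta> (i # us))"
    proof (cases "x = asimple i")
      case False
      then have "srefl i x \<in> lambda_set R a (word us)"
        using lambda_comp_iff[OF i affine_aut_word[OF us] _ False] x lambda_set_subset by auto
      then have "srefl i (srefl i x) \<in> srefl i ` set (lambda_seq a \<theta> us)" using Cons.IH[OF us] by blast
      then show ?thesis using i by simp
    qed simp
  qed
qed

text \<open>The root \<open>asimple i\<close> is the image of some \<open>asimple j\<close> under
  the inverse of the prefix before that letter j. Hence \<open>srefl i\<close> is the conjugate of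
  \<open>srefl j\<close> by this prefix, and multiplying by it deletes the letter.\<close>

lemma exchange:
  assumes i: "i \<in> {0..DIM('a)}" and us: "set us \<subseteq> {0..DIM('a)}" and l: "asimple i \<in> lambda_set R a (word us)"
  shows "\<exists>js. set js \<subseteq> {0..DIM('a)} \<and> length js < length us \<and> word js = word us \<circ> srefl i"
proof -
  have "asimple i \<in> set (lambda_seq a \<theta> us)" using lambda_subset_seq[OF us] l by blast
  then obtain k where k: "k < length us" "asimple i = foldr srefl (take k us) (asimple (us ! k))"
    by (auto simp: lambda_seq_def)
  define pre j post where "pre = take k us" and "j = us ! k" and "post = drop (Suc k) us"
  have s: "us = pre @ j # post" using k by (simp add: pre_def j_def post_def id_take_nth_drop)
  then have sub: "set pre \<subseteq> {0..DIM('a)}" "j \<in> {0..DIM('a)}" "set post \<subseteq> {0..DIM('a)}" using us by auto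
  have e: "asimple i = word (rev pre) (asimple j)" using k by (simp add: foldr_srefl pre_def j_def)
  have lin: "linear (word (rev pre))" using affine_aut_word[of "rev pre"] sub by (simp add: affine_aut_def)
  have inn: "fst (word (rev pre) x) \<bullet> fst (word (rev pre) y) = fst x \<bullet> fst y" for x y
    using word_inner[of "rev pre"] sub by simp
  have "word us (srefl i y) = word (pre @ post) y" for y
  proof -
    let ?z = "word pre y"
    have "srefl i y = srefl i (word (rev pre) ?z)" using word_rev sub by simp
    also have "\<dots> = word (rev pre) (srefl j ?z)" unfolding e by (rule conj_affine_refl[OF lin inn])
    finally show ?thesis unfolding s using word_rev'[OF sub(1)] sub(2) by (simp add: word_append)
  qed
  then have "word (pre @ post) = word us \<circ> srefl i" by auto
  then show ?thesis using sub s by (intro exI[of _ "pre @ post"]) auto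
qed

section \<open>Reduced words and their inversion sets\<close>

lemma affine_length_le: "set js \<subseteq> {0..DIM('a)} \<Longrightarrow> affine_length a \<theta> (word js) \<le> length js"
  unfolding affine_length_def by (rule Least_le) blast

definition reduced :: "nat list \<Rightarrow> bool" where
  "reduced us \<longleftrightarrow> us \<in> reduced_words a \<theta> (word us)"

lemma reduced_iff: "reduced us \<longleftrightarrow>
    set us \<subseteq> {0..DIM('a)} \<and> (\<forall>js. set js \<subseteq> {0..DIM('a)} \<and> word js = word us \<longrightarrow> length us \<le> length js)"
proof
  assume "reduced us"
  then show "set us \<subseteq> {0..DIM('a)} \<and> (\<forall>js. set js \<subseteq> {0..DIM('a)} \<and> word js = word us \<longrightarrow> length us \<le> length js)"
    using affine_length_le by (fastforce simp: reduced_def reduced_words_def)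
next
  assume *: "set us \<subseteq> {0..DIM('a)} \<and> (\<forall>js. set js \<subseteq> {0..DIM('a)} \<and> word js = word us \<longrightarrow> length us \<le> length js)"
  have "affine_length a \<theta> (word us) = length us"
    unfolding affine_length_def by (rule Least_equality) (use * in auto)
  with * show "reduced us" by (simp add: reduced_def reduced_words_def)
qed

lemma reduced_words_iff: "us \<in> reduced_words a \<theta> w \<longleftrightarrow> reduced us \<and> word us = w"
  by (auto simp: reduced_def reduced_words_def)

lemma ex_reduced:
  assumes "w \<in> affine_weyl_group a \<theta>" shows "\<exists>us. reduced us \<and> word us = w"
proof -
  let ?P = "\<lambda>l. \<exists>us. set us \<subseteq> {0..DIM('a)} \<and> length us = l \<and> word us = w"
  have "\<exists>l. ?P l" using assms by (auto simp: affine_weyl_iff)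
  from LeastI_ex[OF this] show ?thesis by (auto simp: reduced_def reduced_words_def affine_length_def)
qed

lemma reduced_append:
  assumes "reduced (xs @ ys)"
  shows "reduced xs" "reduced ys"
proof -
  have sub: "set xs \<subseteq> {0..DIM('a)}" "set ys \<subseteq> {0..DIM('a)}" using assms by (auto simp: reduced_iff)
  have min: "length (xs @ ys) \<le> length js" if "set js \<subseteq> {0..DIM('a)}" "word js = word (xs @ ys)" for js
    using assms that unfolding reduced_iff by blast
  show "reduced xs" unfolding reduced_iff
  proof (intro conjI sub allI impI)
    fix js assume "set js \<subseteq> {0..DIM('a)} \<and> word js = word xs"
    then show "length xs \<le> length js" using min[of "js @ ys"] sub by (simp add: word_append)
  qed
  show "reduced ys" unfolding reduced_iff
  proof (intro conjI sub allI impI)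
    fix js assume "set js \<subseteq> {0..DIM('a)} \<and> word js = word ys"
    then show "length ys \<le> length js" using min[of "xs @ js"] sub by (simp add: word_append)
  qed
qed

lemma reduced_take: "reduced us \<Longrightarrow> reduced (take k us)"
  using reduced_append(1)[of "take k us" "drop k us"] by simp

text \<open>If \<open>asimple i\<close> were already inverted by the rest of the word,
  \<open>exchange\<close> would express \<open>word (i # us)\<close> by fewer letters than us has.
  So each letter adds a new root.\<close>

lemma reduced_lambda:
  "reduced us \<Longrightarrow> distinct (lambda_seq a \<theta> us) \<and> set (lambda_seq a \<theta> us) = lambda_set R a (word us)"
proof (induction us)
  case Nil
  have "lambda_set R a (word []) = {}" using lambda_subset_seq[of "[]"] by simp
  then show ?case by (simp only: lambda_seq_Nil) simp
next
  case (Cons i us)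
  have r: "reduced us" using reduced_append(2)[of "[i]" us] Cons.prems by simp
  have sub: "i \<in> {0..DIM('a)}" "set us \<subseteq> {0..DIM('a)}" using Cons.prems by (auto simp: reduced_iff)
  have n: "asimple i \<notin> lambda_set R a (word us)"
  proof
    assume "asimple i \<in> lambda_set R a (word us)"
    from exchange[OF sub this] obtain js where
      "set js \<subseteq> {0..DIM('a)}" "length js < length us" "word js = word (i # us)" by auto
    then show False using Cons.prems by (fastforce simp: reduced_iff)
  qed
  have "set (lambda_seq a \<theta> (i # us)) = lambda_set R a (word (i # us))"
    using Cons.IH[OF r] lambda_comp[OF sub(1) affine_aut_word[OF sub(2)] n] by (simp add: comp_def)
  moreover have "asimple i \<notin> srefl i ` set (lambda_seq a \<theta> us)"
    using srefl_Apos_ne[OF sub(1)] Cons.IH[OF r] lambda_set_subset by (metis (no_types, lifting) imageE subsetD)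
  moreover have "inj_on (srefl i) (set (lambda_seq a \<theta> us))"
    by (rule inj_onI) (metis simple_refl_invol[OF sub(1)])
  ultimately show ?case using Cons.IH[OF r] by (simp add: distinct_map comp_def)
qed

lemma card_lambda: "reduced us \<Longrightarrow> card (lambda_set R a (word us)) = length us"
  using reduced_lambda[of us] distinct_card[of "lambda_seq a \<theta> us"] by simp

text \<open>Equal inversion sets mean that w composed with the inverse of w' makes no positive root
  negative: the two maps give every root the same sign. By \<open>card_lambda\<close> a reduced word
  of this composite is empty.\<close>

lemma lambda_inj:
  assumes w: "w \<in> affine_weyl_group a \<theta>" "w' \<in> affine_weyl_group a \<theta>"
    and e: "lambda_set R a w = lambda_set R a w'"
  shows "w = w'"
proof -
  obtain us js where s: "set us \<subseteq> {0..DIM('a)}" "w = word us" "set js \<subseteq> {0..DIM('a)}" "w' = word js"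
    using w by (auto simp: affine_weyl_iff)
  have a: "affine_aut w" "affine_aut w'" "affine_aut (word (rev js))" "affine_aut (word (rev js @ us))"
    using affine_aut_word[of us] affine_aut_word[of js] affine_aut_word[of "rev js"] affine_aut_word[of "rev js @ us"] s by simp_all
  have "lambda_set R a (word (rev js @ us)) = {}"
  proof (rule ccontr)
    assume "lambda_set R a (word (rev js @ us)) \<noteq> {}"
    then obtain x where x: "x \<in> Apos" "aht (word (rev js @ us) x) < 0" using lambda_iff[OF a(4)] by blast
    define y where "y = word (rev js) x"
    have y: "aht (w y) < 0" "w' y = x" using x(2) s word_rev' by (simp_all add: y_def word_append)
    have yR: "y \<in> Aroots" using a(3) x(1) Apos_in_Aroots by (auto simp: y_def affine_aut_def)
    have l: "linear w" "linear w'" using a by (auto simp: affine_aut_def)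
    from Apos_or_neg[OF yR] show False
    proof
      assume "y \<in> Apos"
      then show False using y e lambda_iff[OF a(1), of y] lambda_iff[OF a(2), of y] aht_pos[OF x(1)] by simp
    next
      assume "- y \<in> Apos"
      then show False using y e lambda_iff[OF a(1), of "- y"] lambda_iff[OF a(2), of "- y"] aht_pos[OF x(1)]
        by (simp add: linear_neg[OF l(1)] linear_neg[OF l(2)] aht_simps)
    qed
  qed
  moreover have "word (rev js @ us) \<in> affine_weyl_group a \<theta>" using s by (intro word_in_weyl) auto
  then obtain ks where "reduced ks" "word ks = word (rev js @ us)" using ex_reduced by blast
  ultimately have "length ks = 0" using card_lambda by force
  then have id: "word (rev js @ us) = id" using \<open>word ks = _\<close> by simp
  have "w y = w' y" for y
    using fun_cong[OF id, of "word js y"] s word_rev[OF s(3)] by (simp add: word_append)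
  then show ?thesis by auto
qed

lemma lambda_seq_inj:
  "set us \<subseteq> {0..DIM('a)} \<Longrightarrow> set js \<subseteq> {0..DIM('a)} \<Longrightarrow> lambda_seq a \<theta> us = lambda_seq a \<theta> js \<Longrightarrow> us = js"
proof (induction us arbitrary: js)
  case Nil
  then show ?case by (metis length_0_conv length_lambda_seq)
next
  case (Cons i us)
  then obtain j js' where js: "js = j # js'" by (metis length_lambda_seq length_Suc_conv)
  have i: "i \<in> {0..DIM('a)}" "j \<in> {0..DIM('a)}" using Cons.prems js by auto
  have "asimple i = asimple j" using Cons.prems(3) js by simp
  then have ij: "i = j" using inj_onD[OF inj_asimple _ i] by blast
  have "inj (srefl i)" by (rule injI) (metis simple_refl_invol[OF i(1)])
  then have "lambda_seq a \<theta> us = lambda_seq a \<theta> js'"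
    using Cons.prems(3) js ij map_injective by auto
  then show ?case using Cons.IH[of js'] Cons.prems js ij by auto
qed

subsection \<open>The conditions\<close>

lemma cond_a_iff:
  assumes "L \<subseteq> Apos"
  shows "cond_a R a L \<longleftrightarrow> (\<forall>x\<in>L. \<forall>y\<in>L. x + y \<in> Apos \<longrightarrow> x + y \<in> L)"
proof -
  have "x \<notin> {0} \<times> \<int>" if "x \<in> Apos" for x
    using fst_Aroots[OF Apos_in_Aroots[OF that]] zero_notin_R by (cases x) auto
  then show ?thesis unfolding cond_a_def by blast
qed

lemma Apos_shift_levels:
  assumes "x \<in> Apos" "y \<in> Apos" "x = y + (0, t)" "t > 0"
  shows "\<exists>\<alpha> j j'. x = affine_root \<alpha> j \<and> y = affine_root \<alpha> j' \<and> 0 \<le> j' \<and> j' < j"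
proof -
  obtain \<alpha> s where y: "y = (\<alpha>, s)" by (cases y)
  have aR: "\<alpha> \<in> R" using fst_Aroots[OF Apos_in_Aroots[OF assms(2)]] y by simp
  have nu: "\<nu> \<alpha> > 0" using nu_ge_1[OF aR] by simp
  obtain j' :: int where j': "s = \<nu> \<alpha> * of_int j'" using assms(2) y by (auto simp: Apos_iff Aroots_iff)
  obtain j :: int where j: "s + t = \<nu> \<alpha> * of_int j" using assms(1,3) y by (auto simp: Apos_iff Aroots_iff)
  have "s \<ge> 0" using assms(2) y by (auto simp: Apos_iff)
  then have "0 \<le> j'" using j' nu by (simp add: zero_le_mult_iff)
  moreover have "\<nu> \<alpha> * real_of_int j' < \<nu> \<alpha> * real_of_int j" using j j' assms(4) by linarith
  then have "j' < j" using nu by simp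
  ultimately show ?thesis using y j j' assms(3) by (auto simp: affine_root_def)
qed

lemma affine_root_shift:
  assumes "affine_root \<alpha> j \<in> Apos" "j' < j"
  shows "\<exists>t>0. affine_root \<alpha> j = affine_root \<alpha> j' + (0, t)"
proof -
  have "\<alpha> \<in> R" using fst_Aroots[OF Apos_in_Aroots[OF assms(1)]] by (simp add: affine_root_def)
  then have "\<nu> \<alpha> > 0" using nu_ge_1[of \<alpha>] by simp
  then have "\<nu> \<alpha> * (of_int j - of_int j') > 0" using assms(2) by simp
  then show ?thesis
    by (intro exI[of _ "\<nu> \<alpha> * (of_int j - of_int j')"]) (simp add: affine_root_def algebra_simps)
qed

text \<open>Levels are compared through the vector (0, t), which every \<open>affine_aut\<close>
  fixes; in this form the condition is the one that \<open>lambda_shift\<close> provides.\<close>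

lemma cond_e_iff:
  assumes "L \<subseteq> Apos"
  shows "cond_e R a L \<longleftrightarrow> (\<forall>y\<in>Apos. \<forall>t>0. y + (0, t) \<in> L \<longrightarrow> y \<in> L)"
proof
  assume e: "cond_e R a L"
  show "\<forall>y\<in>Apos. \<forall>t>0. y + (0, t) \<in> L \<longrightarrow> y \<in> L"
  proof (intro ballI allI impI)
    fix y t assume y: "y \<in> Apos" "(t::real) > 0" "y + (0, t) \<in> L"
    then obtain \<alpha> j j' where "y + (0, t) = affine_root \<alpha> j" "y = affine_root \<alpha> j'" "0 \<le> j'" "j' < j"
      using Apos_shift_levels[of "y + (0, t)" y t] assms by blast
    then show "y \<in> L" using e y unfolding cond_e_def by metis
  qed
next
  assume *: "\<forall>y\<in>Apos. \<forall>t>0. y + (0, t) \<in> L \<longrightarrow> y \<in> L"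
  show "cond_e R a L" unfolding cond_e_def
  proof (intro allI impI)
    fix \<alpha> j j' assume j: "affine_root \<alpha> j \<in> L \<and> affine_root \<alpha> j' \<in> Apos \<and> 0 \<le> j' \<and> j' < j"
    then obtain t where "t > 0" "affine_root \<alpha> j = affine_root \<alpha> j' + (0, t)" using affine_root_shift[of \<alpha> j j'] assms by blast
    then show "affine_root \<alpha> j' \<in> L" using * j by metis
  qed
qed

text \<open>A reflection changes the labels \<alpha> and j of a root but fixes (0, t), so this form
  can be carried through reflections in \<open>strip_f\<close>.\<close>

lemma cond_f_iff:
  assumes "set xs \<subseteq> Apos"
  shows "cond_f xs \<longleftrightarrow> (\<forall>p<length xs. \<forall>q<length xs. \<forall>t>0. xs ! p = xs ! q + (0, t) \<longrightarrow> q < p)"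
proof
  assume f: "cond_f xs"
  show "\<forall>p<length xs. \<forall>q<length xs. \<forall>t>0. xs ! p = xs ! q + (0, t) \<longrightarrow> q < p"
  proof (intro allI impI)
    fix p q t assume y: "p < length xs" "q < length xs" "(t::real) > 0" "xs ! p = xs ! q + (0, t)"
    then have "xs ! p \<in> Apos" "xs ! q \<in> Apos" using assms nth_mem by blast+
    then obtain \<alpha> j j' where "xs ! p = affine_root \<alpha> j" "xs ! q = affine_root \<alpha> j'" "0 \<le> j'" "j' < j"
      using Apos_shift_levels[of "xs ! p" "xs ! q" t] y by blast
    then show "q < p" using f y(1,2) unfolding cond_f_def by metis
  qed
next
  assume *: "\<forall>p<length xs. \<forall>q<length xs. \<forall>t>0. xs ! p = xs ! q + (0, t) \<longrightarrow> q < p"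
  show "cond_f xs" unfolding cond_f_def
  proof (intro allI impI)
    fix p q \<alpha> j j' assume p: "p < length xs" and q: "q < length xs"
      and j: "xs ! p = affine_root \<alpha> j \<and> xs ! q = affine_root \<alpha> j' \<and> 0 \<le> j' \<and> j' < j"
    have "xs ! p \<in> Apos" using p assms nth_mem by auto
    then obtain t where "t > 0" "affine_root \<alpha> j = affine_root \<alpha> j' + (0, t)" using affine_root_shift[of \<alpha> j j'] j by auto
    then show "q < p" using * p q j by metis
  qed
qed

section \<open>Conditions satisfied by inversion sets and their sequences\<close>

lemma lambda_conds:
  assumes w: "affine_aut w"
  shows "cond_a R a (lambda_set R a w)" "cond_c R a (lambda_set R a w)" "cond_e R a (lambda_set R a w)"
    "cond_a' R a (lambda_set R a w)" "cond_c' R a (lambda_set R a w)"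
proof -
  let ?L = "lambda_set R a w"
  show "cond_a R a ?L" using lambda_cone[OF w, of _ _ 1 1] by (auto simp: cond_a_iff[OF lambda_set_subset])
  show "cond_c R a ?L" using lambda_cocone[OF w, of 1 _ 1] unfolding cond_c_def by (metis scaleR_one zero_less_one)
  show "cond_e R a ?L" using lambda_shift[OF w] by (auto simp: cond_e_iff[OF lambda_set_subset])
  show "cond_a' R a ?L" using lambda_cone[OF w] by (simp add: cond_a'_def)
  show "cond_c' R a ?L" using lambda_cocone[OF w] unfolding cond_c'_def by (metis zero_less_of_rat_iff)
qed

lemma order_conds:
  assumes xs: "distinct xs" "set xs \<subseteq> Apos"
    and pre: "\<And>k. \<exists>w. affine_aut w \<and> set (take k xs) = lambda_set R a w"
  shows "cond_b' xs" "cond_d' R a xs" "cond_f xs"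
proof -
  \<comment> \<open>Distinctness turns comparison of positions into membership in prefixes, to which
    the closure properties apply.\<close>
  have mem: "xs ! q \<in> set (take k xs) \<longleftrightarrow> q < k" if "q < length xs" for q k
  proof
    assume "xs ! q \<in> set (take k xs)"
    then obtain r where "r < length (take k xs)" "take k xs ! r = xs ! q" by (auto simp: in_set_conv_nth)
    then show "q < k" using xs(1) that by (auto simp: nth_eq_iff_index_eq)
  next
    assume "q < k" then show "xs ! q \<in> set (take k xs)"
      using that by (metis in_set_conv_nth length_take min_less_iff_conj nth_take)
  qed
  have AP: "xs ! q \<in> Apos" if "q < length xs" for q using that xs(2) nth_mem by blast
  \<comment> \<open>Reducedness restricts the ratio to 1 or -1, and \<open>aht\<close> decides its
    sign; c is not assumed positive because it will be 1 - u.\<close>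
  have scale: "x = y" if "x \<in> Apos" "y \<in> Apos" "c *\<^sub>R x = d *\<^sub>R y" "c \<noteq> 0" "d > 0" for x y c d
  proof -
    have "c * aht x = d * aht y" using arg_cong[OF that(3), of aht] by (simp add: aht_simps)
    moreover have "d * aht y > 0" using aht_pos[OF that(2)] that(5) by simp
    ultimately have "0 < c * aht x" by linarith
    then have "c > 0" using aht_pos[OF that(1)] by (simp add: zero_less_mult_iff)
    have e: "y = (c / d) *\<^sub>R x" using arg_cong[OF that(3), of "\<lambda>z. (1 / d) *\<^sub>R z"] that(5) by simp
    have "(c / d) *\<^sub>R fst x \<in> R" "fst x \<in> R" using fst_Aroots Apos_in_Aroots that(1,2) e by (metis fst_scaleR)+
    then have "c / d = 1 \<or> c / d = -1" using scaleR_in_R by blast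
    moreover have "c / d > 0" using \<open>c > 0\<close> that(5) by simp
    ultimately show ?thesis using e by simp
  qed
  \<comment> \<open>With rational coefficients the equation x = u x + v y is conceivable. It makes x
    and y proportional, hence equal as positive roots.\<close>
  have ray: "p \<noteq> q" if "p < length xs" "q < length xs" "y \<in> Apos" "y \<noteq> xs ! q" "u > 0" "v > 0"
    "xs ! p = u *\<^sub>R xs ! q + v *\<^sub>R y" for p q y and u v :: real
  proof
    assume "p = q"
    then have e: "(1 - u) *\<^sub>R xs ! q = v *\<^sub>R y" using that(7) by (simp add: algebra_simps)
    show False
    proof (cases "u = 1")
      case True
      then have "y = 0" using e that(6) by simp
      then show False using that(3) zero_notin_Apos by simp
    next
      case False
      then show False using scale[OF AP[OF that(2)] that(3) e] that(4,6) by simp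
    qed
  qed
  show "cond_b' xs" unfolding cond_b'_def
  proof (intro allI impI)
    fix u v :: rat and p q r
    assume uv: "0 < u \<and> 0 < v" and pqr: "p < length xs" "q < length xs" "r < length xs"
      and e: "q \<noteq> r \<and> xs ! p = of_rat u *\<^sub>R xs ! q + of_rat v *\<^sub>R xs ! r"
    let ?u = "of_rat u :: real" and ?v = "of_rat v :: real"
    have uv': "?u > 0" "?v > 0" using uv by auto
    have ne: "xs ! q \<noteq> xs ! r" "xs ! r \<noteq> xs ! q" using e pqr xs(1) by (auto simp: nth_eq_iff_index_eq)
    have e': "xs ! p = ?u *\<^sub>R xs ! q + ?v *\<^sub>R xs ! r" "xs ! p = ?v *\<^sub>R xs ! r + ?u *\<^sub>R xs ! q"
      using e by (simp_all add: add.commute)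
    have pq: "p \<noteq> q" "p \<noteq> r"
      using ray[OF pqr(1,2) AP[OF pqr(3)] ne(2) uv' e'(1)] ray[OF pqr(1,3) AP[OF pqr(2)] ne(1) uv'(2,1) e'(2)] by auto
    \<comment> \<open>The prefix of length p stops just before position p: if it contained both
      terms, it would contain their combination.\<close>
    have "\<not> (q < p \<and> r < p)"
    proof
      assume *: "q < p \<and> r < p"
      obtain w where w: "affine_aut w" "set (take p xs) = lambda_set R a w" using pre by blast
      have "xs ! q \<in> lambda_set R a w" "xs ! r \<in> lambda_set R a w" using * mem pqr w(2) by auto
      from lambda_cone[OF w(1) this uv'] have "xs ! p \<in> set (take p xs)" using e'(1) AP[OF pqr(1)] w(2) by simp
      then show False using mem pqr by simp
    qed
    \<comment> \<open>The prefix of length \<open>Suc p\<close> includes position p, so it must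
      contain one of the two terms.\<close>
    moreover have "\<not> (p < q \<and> p < r)"
    proof
      assume *: "p < q \<and> p < r"
      obtain w where w: "affine_aut w" "set (take (Suc p) xs) = lambda_set R a w" using pre by blast
      have "xs ! p \<in> lambda_set R a w" using mem pqr w(2) by auto
      then have "xs ! q \<in> set (take (Suc p) xs) \<or> xs ! r \<in> set (take (Suc p) xs)"
        using lambda_cocone[OF w(1), of ?u "xs ! q" ?v "xs ! r"] uv' AP pqr w(2) e'(1) by simp
      then show False using mem pqr * by simp
    qed
    ultimately show "between p q r" using pq by (auto simp: between_def)
  qed
  show "cond_d' R a xs" unfolding cond_d'_def
  proof (intro allI impI ballI)
    fix u v :: rat and p q \<gamma>
    assume uv: "0 < u \<and> 0 < v" and pq: "p < length xs" "q < length xs" and g: "\<gamma> \<in> Apos"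
      and e: "\<gamma> \<notin> set xs \<and> xs ! p = of_rat u *\<^sub>R xs ! q + of_rat v *\<^sub>R \<gamma>"
    let ?u = "of_rat u :: real" and ?v = "of_rat v :: real"
    have uv': "?u > 0" "?v > 0" using uv by auto
    have "\<gamma> \<noteq> xs ! q" using e pq nth_mem by metis
    with e have "p \<noteq> q" using ray[OF pq g _ uv'] by blast
    obtain w where w: "affine_aut w" "set (take (Suc p) xs) = lambda_set R a w" using pre by blast
    have "xs ! p \<in> lambda_set R a w" using mem pq w(2) by auto
    then have "xs ! q \<in> set (take (Suc p) xs) \<or> \<gamma> \<in> set (take (Suc p) xs)"
      using lambda_cocone[OF w(1), of ?u "xs ! q" ?v \<gamma>] uv' AP pq g w(2) e by simp
    moreover have "\<gamma> \<notin> set (take (Suc p) xs)" using e by (meson in_set_takeD)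
    ultimately show "q < p" using mem[OF pq(2)] \<open>p \<noteq> q\<close> by simp
  qed
  show "cond_f xs" unfolding cond_f_iff[OF xs(2)]
  proof (intro allI impI)
    fix p q and t :: real
    assume pq: "p < length xs" "q < length xs" and t: "t > 0" and e: "xs ! p = xs ! q + (0, t)"
    obtain w where w: "affine_aut w" "set (take (Suc p) xs) = lambda_set R a w" using pre by blast
    have "xs ! q + (0, t) \<in> lambda_set R a w" using mem pq w(2) e by (metis lessI)
    then have "xs ! q \<in> set (take (Suc p) xs)" using lambda_shift[OF w(1) _ AP[OF pq(2)] t] w(2) by simp
    moreover have "p \<noteq> q" using e t by (auto simp: prod_eq_iff)
    ultimately show "q < p" using mem[OF pq(2)] by simp
  qed
qed

lemma rational_conds:
  "cond_a' R a L \<Longrightarrow> cond_a R a L"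
  "cond_c' R a L \<Longrightarrow> cond_c R a L"
  "cond_d' R a xs \<Longrightarrow> cond_d R a xs"
  unfolding cond_a_def cond_a'_def cond_c_def cond_c'_def cond_d_def cond_d'_def
  by (metis of_rat_1 scaleR_one zero_less_one)+

text \<open>The proviso q \<noteq> r of \<open>cond_b'\<close> is met because twice a root is not a
  root.\<close>

lemma rational_cond_b:
  assumes "cond_b' xs" "set xs \<subseteq> Apos"
  shows "cond_b xs"
  unfolding cond_b_def
proof (intro allI impI)
  fix p q r assume pqr: "p < length xs" "q < length xs" "r < length xs" and e: "xs ! p = xs ! q + xs ! r"
  have "q \<noteq> r"
  proof
    assume "q = r"
    then have "xs ! p = 2 *\<^sub>R xs ! q" using e by (simp add: scaleR_2)
    moreover have "fst (xs ! p) \<in> R" "fst (xs ! q) \<in> R" using pqr assms(2) fst_Aroots Apos_in_Aroots nth_mem by blast+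
    ultimately show False using scaleR_in_R[of "fst (xs ! q)" 2] by simp
  qed
  moreover have "xs ! p = of_rat 1 *\<^sub>R xs ! q + of_rat 1 *\<^sub>R xs ! r" using e by simp
  ultimately show "between p q r" using assms(1) pqr unfolding cond_b'_def by (metis zero_less_one)
qed

lemma reduced_conds:
  assumes "reduced us"
  shows "conds_abcdef R a (lambda_seq a \<theta> us)" "conds_abcd' R a (lambda_seq a \<theta> us)"
proof -
  let ?xs = "lambda_seq a \<theta> us"
  have r: "distinct ?xs" "set ?xs = lambda_set R a (word us)" using reduced_lambda[OF assms] by auto
  have s: "set us \<subseteq> {0..DIM('a)}" using assms by (simp add: reduced_iff)
  have AP: "set ?xs \<subseteq> Apos" using r(2) lambda_set_subset by simp
  have "\<exists>w. affine_aut w \<and> set (take k ?xs) = lambda_set R a w" for k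
  proof -
    have "set (take k us) \<subseteq> {0..DIM('a)}" using s by (meson order.trans set_take_subset)
    from affine_aut_word[OF this] show ?thesis
      using reduced_lambda[OF reduced_take[OF assms, of k]] unfolding take_lambda_seq by blast
  qed
  note o = order_conds[OF r(1) AP this]
  note l = lambda_conds[OF affine_aut_word[OF s], folded r(2)]
  show "conds_abcd' R a ?xs" using o l by (simp add: conds_abcd'_def)
  show "conds_abcdef R a ?xs" using o l rational_conds(3) rational_cond_b[OF _ AP]
    by (simp add: conds_abcdef_def conds_abcd_def)
qed

section \<open>Removing a simple root\<close>

lemma linear_srefl: "linear (srefl i)"
  by (rule linear_affine_refl)

lemma srefl_shift: "srefl i (x + (0, t)) = srefl i x + (0, t)"
  by (simp add: linear_add[OF linear_affine_refl])

lemma strip_Apos: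
  assumes "i \<in> {0..DIM('a)}" "L \<subseteq> Apos"
  shows "srefl i ` (L - {asimple i}) \<subseteq> Apos"
  using simple_refl_Apos[OF assms(1)] assms(2) by blast

text \<open>A simple root is not a sum of positive roots, so neither the sum before reflection nor
  the one after it can be \<open>asimple i\<close>. Positivity thus passes through the reflection,
  and the sum is not the removed root.\<close>

lemma strip_a:
  assumes i: "i \<in> {0..DIM('a)}" and L: "L \<subseteq> Apos" and a: "cond_a R a L"
  shows "cond_a R a (srefl i ` (L - {asimple i}))"
  unfolding cond_a_iff[OF strip_Apos[OF i L]]
proof (intro ballI impI)
  fix x' y' assume x': "x' \<in> srefl i ` (L - {asimple i})" "y' \<in> srefl i ` (L - {asimple i})" and s: "x' + y' \<in> Apos"
  then obtain x y where x: "x \<in> L" "x' = srefl i x" and y: "y \<in> L" "y' = srefl i y" by blast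
  have "x' \<in> Apos" "y' \<in> Apos" using x' strip_Apos[OF i L] by auto
  then have "x' + y' \<noteq> asimple i" using asimple_not_sum[OF i] by metis
  from simple_refl_Apos[OF i s this] have "x + y \<in> Apos" using x y i by (simp add: linear_add[OF linear_srefl])
  then have "x + y \<in> L" using a x y by (simp add: cond_a_iff[OF L])
  moreover have "x + y \<noteq> asimple i" using asimple_not_sum[OF i] x y L by (metis subsetD)
  moreover have "x' + y' = srefl i (x + y)" using x y by (simp add: linear_add[OF linear_srefl])
  ultimately show "x' + y' \<in> srefl i ` (L - {asimple i})" by blast
qed

lemma strip_mem:
  assumes i: "i \<in> {0..DIM('a)}"
  shows "x \<in> srefl i ` (L - {asimple i}) \<longleftrightarrow> srefl i x \<in> L \<and> srefl i x \<noteq> asimple i"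
proof
  assume "srefl i x \<in> L \<and> srefl i x \<noteq> asimple i"
  then have "srefl i (srefl i x) \<in> srefl i ` (L - {asimple i})" by blast
  then show "x \<in> srefl i ` (L - {asimple i})" using i by simp
qed (use i in auto)

lemma strip_mem_Apos:
  assumes "i \<in> {0..DIM('a)}" "x \<in> Apos"
  shows "x \<in> srefl i ` (L - {asimple i}) \<longleftrightarrow> srefl i x \<in> L"
  using strip_mem[OF assms(1)] srefl_Apos_ne[OF assms] by blast

text \<open>The new case is that a summand equals \<open>asimple i\<close>, which the reflection
  makes negative. Moved to the other side, it writes the second reflected summand as a sum of two
  elements of L, and (a) takes the place of (c).\<close>

lemma strip_c:
  assumes i: "i \<in> {0..DIM('a)}" and L: "L \<subseteq> Apos" "asimple i \<in> L" and a: "cond_a R a L" and c: "cond_c R a L"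
  shows "cond_c R a (srefl i ` (L - {asimple i}))"
  unfolding cond_c_def
proof (intro ballI impI)
  let ?L = "srefl i ` (L - {asimple i})"
  fix x \<beta> \<gamma> assume x: "x \<in> ?L" and b: "\<beta> \<in> Apos" and g: "\<gamma> \<in> Apos" and e: "x = \<beta> + \<gamma>"
  have xL: "srefl i x \<in> L" using x strip_mem[OF i] by blast
  have e': "srefl i x = srefl i \<beta> + srefl i \<gamma>" using e by (simp add: linear_add[OF linear_srefl])
  have ne: "\<not> (\<beta> = asimple i \<and> \<gamma> = asimple i)"
  proof
    assume *: "\<beta> = asimple i \<and> \<gamma> = asimple i"
    then have "aht (srefl i x) = - 2 * aht (asimple i)" using e' simple_refl_asimple[OF i] by (simp add: aht_simps)
    then show False using aht_pos[OF asimple_Apos[OF i]] aht_pos[of "srefl i x"] xL L(1) by auto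
  qed
  have one: "srefl i \<delta> \<in> L" if "srefl i x = - asimple i + srefl i \<delta>" "\<delta> \<in> Apos" "\<delta> \<noteq> asimple i" for \<delta>
  proof -
    have "srefl i \<delta> = srefl i x + asimple i" using that(1) by simp
    then show ?thesis using a xL L simple_refl_Apos[OF i that(2,3)] by (simp add: cond_a_iff[OF L(1)])
  qed
  consider "\<beta> = asimple i" "\<gamma> \<noteq> asimple i" | "\<gamma> = asimple i" "\<beta> \<noteq> asimple i" | "\<beta> \<noteq> asimple i" "\<gamma> \<noteq> asimple i" using ne by blast
  then have "srefl i \<beta> \<in> L \<or> srefl i \<gamma> \<in> L"
  proof cases
    case 1 then show ?thesis using one[OF _ g] e' simple_refl_asimple[OF i] by simp
  next
    case 2 then show ?thesis using one[OF _ b] e' simple_refl_asimple[OF i] by (simp add: add.commute)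
  next
    case 3 then show ?thesis using c xL e' simple_refl_Apos[OF i b] simple_refl_Apos[OF i g] unfolding cond_c_def by blast
  qed
  then show "\<beta> \<in> ?L \<or> \<gamma> \<in> ?L" using strip_mem_Apos[OF i] b g by blast
qed

lemma strip_b:
  assumes i: "i \<in> {0..DIM('a)}" and b: "cond_b (asimple i # ys)"
  shows "cond_b (map (srefl i) ys)"
  unfolding cond_b_def
proof (intro allI impI)
  fix p q r assume l: "p < length (map (srefl i) ys)" "q < length (map (srefl i) ys)" "r < length (map (srefl i) ys)"
    and e: "map (srefl i) ys ! p = map (srefl i) ys ! q + map (srefl i) ys ! r"
  have "srefl i (srefl i (ys ! p)) = srefl i (srefl i (ys ! q + ys ! r))"
    using e l by (simp add: linear_add[OF linear_srefl])
  then have "(asimple i # ys) ! Suc p = (asimple i # ys) ! Suc q + (asimple i # ys) ! Suc r" using i by simp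
  moreover have "Suc p < length (asimple i # ys)" "Suc q < length (asimple i # ys)" "Suc r < length (asimple i # ys)" using l by auto
  ultimately have "between (Suc p) (Suc q) (Suc r)" using b unfolding cond_b_def by blast
  then show "between p q r" by (simp add: between_def)
qed

text \<open>For \<gamma> = \<open>asimple i\<close>, which has left the list, reflecting the
  equation exhibits entry \<open>Suc q\<close> of the full list as the sum of entries
  \<open>Suc p\<close> and 0; then (b) places q before p.\<close>

lemma strip_d:
  assumes i: "i \<in> {0..DIM('a)}" and L: "set (asimple i # ys) \<subseteq> Apos" "distinct (asimple i # ys)"
    and b: "cond_b (asimple i # ys)" and d: "cond_d R a (asimple i # ys)"
  shows "cond_d R a (map (srefl i) ys)"
  unfolding cond_d_def
proof (intro allI impI ballI)
  let ?xs = "asimple i # ys"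
  fix p q \<gamma> assume l: "p < length (map (srefl i) ys)" "q < length (map (srefl i) ys)" and g: "\<gamma> \<in> Apos"
    and e: "\<gamma> \<notin> set (map (srefl i) ys) \<and> map (srefl i) ys ! p = map (srefl i) ys ! q + \<gamma>"
  have "srefl i (srefl i (ys ! p)) = srefl i (srefl i (ys ! q) + \<gamma>)"
    using e l by simp
  then have e': "?xs ! Suc p = ?xs ! Suc q + srefl i \<gamma>" using i by (simp add: linear_add[OF linear_srefl])
  have l': "Suc p < length ?xs" "Suc q < length ?xs" "0 < length ?xs" using l by auto
  show "q < p"
  proof (cases "\<gamma> = asimple i")
    case True
    then have "?xs ! Suc q = ?xs ! Suc p + ?xs ! 0" using e' simple_refl_asimple[OF i] by simp
    then have "between (Suc q) (Suc p) 0" using b l' unfolding cond_b_def by blast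
    then show ?thesis by (simp add: between_def)
  next
    case False
    have "srefl i \<gamma> \<notin> set ys"
    proof
      assume "srefl i \<gamma> \<in> set ys"
      then have "srefl i (srefl i \<gamma>) \<in> srefl i ` set ys" by blast
      then show False using e i by simp
    qed
    then have "srefl i \<gamma> \<notin> set ?xs" using srefl_Apos_ne[OF i g] by simp
    then have "Suc q < Suc p" using d l' e' simple_refl_Apos[OF i g False] unfolding cond_d_def by blast
    then show ?thesis by simp
  qed
qed

lemma strip_f:
  assumes i: "i \<in> {0..DIM('a)}" and L: "set (asimple i # ys) \<subseteq> Apos" "set (map (srefl i) ys) \<subseteq> Apos"
    and f: "cond_f (asimple i # ys)"
  shows "cond_f (map (srefl i) ys)"
  unfolding cond_f_iff[OF L(2)]
proof (intro allI impI)
  let ?xs = "asimple i # ys"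
  fix p q and t :: real assume l: "p < length (map (srefl i) ys)" "q < length (map (srefl i) ys)" and t: "t > 0"
    and e: "map (srefl i) ys ! p = map (srefl i) ys ! q + (0, t)"
  have "srefl i (srefl i (ys ! p)) = srefl i (srefl i (ys ! q) + (0, t))" using e l by simp
  then have e': "?xs ! Suc p = ?xs ! Suc q + (0, t)" using i by (simp add: srefl_shift)
  have "Suc p < length ?xs" "Suc q < length ?xs" using l by auto
  then have "Suc q < Suc p" using f e' t unfolding cond_f_iff[OF L(1)] by blast
  then show "q < p" by simp
qed

text \<open>One summand is listed, by (c). If both are, (b) would put position 0 between two
  positions; if only one is, (d) would put it before position 0.\<close>

lemma first_not_sum:
  assumes b: "cond_b (x # ys)" and c: "cond_c R a (set (x # ys))" and d: "cond_d R a (x # ys)"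
    and bg: "\<beta> \<in> Apos" "\<gamma> \<in> Apos"
  shows "x \<noteq> \<beta> + \<gamma>"
proof
  let ?xs = "x # ys"
  assume e: "x = \<beta> + \<gamma>"
  have half: False if bg: "\<beta> \<in> set ?xs" "\<beta> \<in> Apos" "\<gamma> \<in> Apos" "x = \<beta> + \<gamma>" for \<beta> \<gamma>
  proof -
    obtain q where q: "q < length ?xs" "?xs ! q = \<beta>" using bg(1) by (metis in_set_conv_nth)
    have x0: "0 < length ?xs" "?xs ! 0 = x" by auto
    show False
    proof (cases "\<gamma> \<in> set ?xs")
      case True
      then obtain r where r: "r < length ?xs" "?xs ! r = \<gamma>" by (metis in_set_conv_nth)
      have "?xs ! 0 = ?xs ! q + ?xs ! r" using x0 q r bg(4) by simp
      then have "between 0 q r" using b x0(1) q(1) r(1) unfolding cond_b_def by blast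
      then show False by (simp add: between_def)
    next
      case False
      have "?xs ! 0 = ?xs ! q + \<gamma>" using x0 q bg(4) by simp
      then have "q < 0" using d x0(1) q(1) bg(3) False unfolding cond_d_def by blast
      then show False by simp
    qed
  qed
  have "\<beta> \<in> set ?xs \<or> \<gamma> \<in> set ?xs" using c bg e unfolding cond_c_def by force
  then show False using half[of \<beta> \<gamma>] half[of \<gamma> \<beta>] bg e by (auto simp: add.commute)
qed

lemma first_not_shift:
  assumes L: "set (x # ys) \<subseteq> Apos" and e: "cond_e R a (set (x # ys))" and f: "cond_f (x # ys)"
    and y: "y \<in> Apos" "t > 0"
  shows "x \<noteq> y + (0, t)"
proof
  let ?xs = "x # ys"
  assume x: "x = y + (0, t)"
  then have "y \<in> set ?xs" using e y unfolding cond_e_iff[OF L] by force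
  then obtain q where q: "q < length ?xs" "?xs ! q = y" by (metis in_set_conv_nth)
  have "?xs ! 0 = ?xs ! q + (0, t)" "0 < length ?xs" using x q by simp_all
  then have "q < 0" using f q(1) y(2) unfolding cond_f_iff[OF L] by blast
  then show False by simp
qed

section \<open>Reconstructing words from sequences and sets\<close>

lemma lambda_id: "lambda_set R a id = {}" "lambda_set R a (\<lambda>x. x) = {}"
  using lambda_subset_seq[of "[]"] by (simp_all add: id_def)

text \<open>The last assumption brings rank one into the same induction: there the set is some
  \<lambda>(w) from the outset, which supplies (e), and only its ordering has to be realised.
  Assuming (e) itself would not survive the removal of a simple root: in rank one, {[\<alpha>, 0],
  [-\<alpha>, 1]} with \<alpha> simple satisfies it, but removing [\<alpha>, 0] and reflecting
  leaves {[\<alpha>, 1]}.\<close>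

lemma lambda_seq_exists:
  assumes "distinct xs" "set xs \<subseteq> Apos" "cond_a R a (set xs)" "cond_b xs" "cond_c R a (set xs)" "cond_d R a xs"
    and "DIM('a) \<ge> 2 \<or> cond_f xs \<and> (\<exists>js. set js \<subseteq> {0..DIM('a)} \<and> lambda_set R a (word js) = set xs)"
  shows "\<exists>us. set us \<subseteq> {0..DIM('a)} \<and> lambda_seq a \<theta> us = xs \<and> lambda_set R a (word us) = set xs"
  using assms
proof (induction "length xs" arbitrary: xs)
  case 0
  then show ?case using lambda_id by (intro exI[of _ "[]"]) simp
next
  case (Suc n)
  obtain x ys where xs: "xs = x # ys" using Suc.hyps(2) by (cases xs) auto
  note P = Suc.prems[unfolded xs]
  have xAP: "x \<in> Apos" using P(2) by simp
  have "x \<in> asimple ` {0..DIM('a)}"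
  proof (cases "DIM('a) \<ge> 2")
    case True
    then show ?thesis using Apos_decompose[OF xAP] first_not_sum[OF P(4,5,6)] by blast
  next
    case False
    then obtain js where js: "cond_f (x # ys)" "set js \<subseteq> {0..DIM('a)}" "lambda_set R a (word js) = set (x # ys)"
      using P(7) by blast
    then have "cond_e R a (set (x # ys))" using lambda_conds(3)[OF affine_aut_word[OF js(2)]] by simp
    then show ?thesis
      using Apos_decompose_weak[OF xAP] first_not_sum[OF P(4,5,6)] first_not_shift[OF P(2) _ js(1)] by blast
  qed
  then obtain i where i: "i \<in> {0..DIM('a)}" "x = asimple i" by blast
  let ?zs = "map (srefl i) ys"
  have st: "set ?zs = srefl i ` (set (x # ys) - {asimple i})" using P(1) i(2) by auto
  have zAP: "set ?zs \<subseteq> Apos" unfolding st using strip_Apos[OF i(1) P(2)] .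
  have inj: "inj_on (srefl i) (set ys)" by (rule inj_onI) (metis simple_refl_invol[OF i(1)])
  have m: "asimple i \<in> set (x # ys)" using i by simp
  have "\<exists>us. set us \<subseteq> {0..DIM('a)} \<and> lambda_seq a \<theta> us = ?zs \<and> lambda_set R a (word us) = set ?zs"
  proof (rule Suc.hyps(1))
    show "n = length ?zs" using Suc.hyps(2) xs by simp
    show "distinct ?zs" using P(1) inj by (simp add: distinct_map)
    show "set ?zs \<subseteq> Apos" by (rule zAP)
    show "cond_a R a (set ?zs)" unfolding st by (rule strip_a[OF i(1) P(2,3)])
    show "cond_c R a (set ?zs)" unfolding st by (rule strip_c[OF i(1) P(2) m P(3,5)])
    show "cond_b ?zs" by (rule strip_b[OF i(1) P(4)[unfolded i(2)]])
    show "cond_d R a ?zs" by (rule strip_d[OF i(1) P(2,1,4,6)[unfolded i(2)]])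
    show "DIM('a) \<ge> 2 \<or> cond_f ?zs \<and> (\<exists>js. set js \<subseteq> {0..DIM('a)} \<and> lambda_set R a (word js) = set ?zs)"
    proof (cases "DIM('a) \<ge> 2")
      case False
      then obtain js where js: "cond_f (x # ys)" "set js \<subseteq> {0..DIM('a)}" "lambda_set R a (word js) = set (x # ys)"
        using P(7) by blast
      \<comment> \<open>Since \<open>asimple i\<close> is inverted by \<open>word js\<close>,
        prefixing i to js removes it from the inversion set instead of adding it.\<close>
      have "lambda_set R a (word (i # js)) = set ?zs"
      proof (rule set_eqI)
        fix z
        show "z \<in> lambda_set R a (word (i # js)) \<longleftrightarrow> z \<in> set ?zs"
        proof (cases "z \<in> Apos \<and> z \<noteq> asimple i")
          case True
          then show ?thesis unfolding st
            using lambda_comp_iff[OF i(1) affine_aut_word[OF js(2)], of z] js(3) strip_mem_Apos[OF i(1), of z "set (x # ys)"]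
            by (simp add: comp_def)
        next
          case False
          have l: "linear (word js)" using affine_aut_word[OF js(2)] by (simp add: affine_aut_def)
          have "asimple i \<in> lambda_set R a (word js)" using js(3) m by simp
          then have "asimple i \<notin> lambda_set R a (word (i # js))"
            using lambda_iff[OF affine_aut_word[OF js(2)]] lambda_iff[OF affine_aut_word[of "i # js"]] js(2) i(1)
              simple_refl_asimple[OF i(1)] by (simp add: linear_neg[OF l] aht_simps)
          moreover have "asimple i \<notin> set ?zs" unfolding st
            using strip_mem[OF i(1)] simple_refl_asimple[OF i(1)] not_Apos_uminus[OF asimple_Apos[OF i(1)]] P(2) by (metis subsetD)
          ultimately show ?thesis using False zAP lambda_set_subset by blast
        qed
      qed
      moreover have "cond_f ?zs" using strip_f[OF i(1)] P(2) zAP js(1) i(2) by blast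
      ultimately show ?thesis using js(2) i(1) by (intro disjI2 conjI exI[of _ "i # js"]) auto
    qed simp
  qed
  then obtain us where us: "set us \<subseteq> {0..DIM('a)}" "lambda_seq a \<theta> us = ?zs" "lambda_set R a (word us) = set ?zs" by blast
  have inv: "map (srefl i) ?zs = ys" using i(1) by (simp add: comp_def)
  have n: "asimple i \<notin> lambda_set R a (word us)" unfolding us(3) st
    using strip_mem[OF i(1)] simple_refl_asimple[OF i(1)] not_Apos_uminus[OF asimple_Apos[OF i(1)]] P(2) by (metis subsetD)
  have "lambda_set R a (word (i # us)) = insert (asimple i) (srefl i ` set ?zs)"
    using lambda_comp[OF i(1) affine_aut_word[OF us(1)] n] us(3) by (simp add: comp_def)
  also have "srefl i ` set ?zs = set ys" using i(1) by (simp add: image_image)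
  finally have "lambda_set R a (word (i # us)) = set xs" using xs i by (simp add: comp_def)
  moreover have "lambda_seq a \<theta> (i # us) = xs" using us(2) inv xs i by simp
  ultimately show ?case using us(1) i(1) by (intro exI[of _ "i # us"]) simp
qed

lemma lambda_set_exists:
  assumes "finite L" "L \<subseteq> Apos" "cond_a R a L" "cond_c R a L" and rank: "DIM('a) \<ge> 2"
  shows "\<exists>us. set us \<subseteq> {0..DIM('a)} \<and> lambda_set R a (word us) = L"
  using assms(1-4)
proof (induction "card L" arbitrary: L)
  case 0
  then show ?case using lambda_id by (intro exI[of _ "[]"]) simp
next
  case (Suc n)
  then have "L \<noteq> {}" by auto
  then obtain x where x: "x \<in> L" "\<And>y. y \<in> L \<Longrightarrow> aht x \<le> aht y"
    using ex_min_if_finite[of "aht ` L"] Suc.prems(1) by (auto simp: not_less)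
  \<comment> \<open>By (c) one summand lies in L, and its \<open>aht\<close> is smaller than that of
    x because the other summand has positive \<open>aht\<close>.\<close>
  have "x \<noteq> \<beta> + \<gamma>" if "\<beta> \<in> Apos" "\<gamma> \<in> Apos" for \<beta> \<gamma>
  proof
    assume e: "x = \<beta> + \<gamma>"
    then have "\<beta> \<in> L \<or> \<gamma> \<in> L" using Suc.prems(4) x(1) that unfolding cond_c_def by blast
    then show False using x(2)[of \<beta>] x(2)[of \<gamma>] e aht_pos[OF that(1)] aht_pos[OF that(2)] by (auto simp: aht_simps)
  qed
  then obtain i where i: "i \<in> {0..DIM('a)}" "x = asimple i"
    using Apos_decompose[OF _ rank, of x] x(1) Suc.prems(2) by blast
  let ?L = "srefl i ` (L - {asimple i})"
  have m: "asimple i \<in> L" using x i by simp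
  have inj: "inj_on (srefl i) (L - {asimple i})" by (rule inj_onI) (metis simple_refl_invol[OF i(1)])
  have "\<exists>us. set us \<subseteq> {0..DIM('a)} \<and> lambda_set R a (word us) = ?L"
  proof (rule Suc.hyps(1))
    show "n = card ?L" using card_image[OF inj] Suc.hyps(2) Suc.prems(1) m by simp
    show "finite ?L" using Suc.prems(1) by simp
    show "?L \<subseteq> Apos" by (rule strip_Apos[OF i(1) Suc.prems(2)])
    show "cond_a R a ?L" by (rule strip_a[OF i(1) Suc.prems(2,3)])
    show "cond_c R a ?L" by (rule strip_c[OF i(1) Suc.prems(2) m Suc.prems(3,4)])
  qed
  then obtain us where us: "set us \<subseteq> {0..DIM('a)}" "lambda_set R a (word us) = ?L" by blast
  have n: "asimple i \<notin> lambda_set R a (word us)" unfolding us(2)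
    using strip_mem[OF i(1)] simple_refl_asimple[OF i(1)] not_Apos_uminus[OF asimple_Apos[OF i(1)]] Suc.prems(2) by (metis subsetD)
  have "lambda_set R a (word (i # us)) = insert (asimple i) (srefl i ` ?L)"
    using lambda_comp[OF i(1) affine_aut_word[OF us(1)] n] us(2) by (simp add: comp_def)
  also have "srefl i ` ?L = L - {asimple i}" using i(1) by (simp add: image_image)
  finally have "lambda_set R a (word (i # us)) = L" using m by (simp add: comp_def insert_absorb)
  then show ?case using us(1) i(1) by (intro exI[of _ "i # us"] conjI) simp_all
qed

subsection \<open>Sequences and reduced words\<close>

text \<open>Counting suffices: a reduced word of the same element has as many letters as the
  inversion set has roots, and us lists each of these once.\<close>

lemma reduced_if_lambda:
  assumes "set us \<subseteq> {0..DIM('a)}" "distinct (lambda_seq a \<theta> us)" "lambda_set R a (word us) = set (lambda_seq a \<theta> us)"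
  shows "reduced us"
proof -
  obtain ks where ks: "reduced ks" "word ks = word us" using ex_reduced[OF word_in_weyl[OF assms(1)]] by blast
  have "length ks = length us"
    using card_lambda[OF ks(1)] ks(2) assms(2,3) distinct_card[OF assms(2)] by simp
  then show ?thesis using ks assms(1) unfolding reduced_iff by metis
qed

section \<open>Membership in the extended affine Weyl group\<close>

lemma generated_comp: "u \<in> generated S \<Longrightarrow> v \<in> generated S \<Longrightarrow> u \<circ> v \<in> generated S"
  by (induction rule: generated.induct) (simp_all add: comp_assoc generated.comp)

lemma weyl_comp: "u \<in> weyl_group R \<Longrightarrow> \<alpha> \<in> R \<Longrightarrow> u \<circ> affine_refl (\<alpha>, 0) \<in> weyl_group R"
  unfolding weyl_group_def
  using generated_comp[of u _ "affine_refl (\<alpha>, 0) \<circ> id"]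
  by (metis (mono_tags, lifting) comp_id generated.comp generated.id mem_Collect_eq)

lemma translation_add: "translation b \<circ> translation c = translation (b + c)"
  by (auto simp: translation_def inner_add_right)

text \<open>This is the relation of the semidirect product: the translation on the right is by the
  reflected weight.\<close>

lemma translation_refl:
  assumes "\<alpha> \<in> R"
  shows "translation b \<circ> affine_refl (\<alpha>, 0) = affine_refl (\<alpha>, 0) \<circ> translation (b - (b \<bullet> coroot \<alpha>) *\<^sub>R \<alpha>)"
proof
  fix z :: "'a \<times> real"
  have "(fst z \<bullet> coroot \<alpha>) * (\<alpha> \<bullet> b) = (b \<bullet> coroot \<alpha>) * (fst z \<bullet> \<alpha>)"
    by (simp add: inner_coroot inner_commute[of \<alpha> b])
  then show "(translation b \<circ> affine_refl (\<alpha>, 0)) z = (affine_refl (\<alpha>, 0) \<circ> translation (b - (b \<bullet> coroot \<alpha>) *\<^sub>R \<alpha>)) z"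
    by (simp add: translation_def affine_refl_def prod_eq_iff inner_diff_left inner_diff_right)
qed

text \<open>As \<theta> is its own coroot, the only generator outside the finite Weyl group becomes
  a finite reflection times a translation by a lattice vector.\<close>

lemma srefl_0: "srefl 0 = affine_refl (\<theta>, 0) \<circ> translation (- \<theta>)"
  by (auto simp: translation_def affine_refl_def affine_simple_def coroot_theta prod_eq_iff)

lemma extended_comp_refl:
  assumes w: "w \<in> extended_weyl_group R" and \<alpha>: "\<alpha> \<in> R"
  shows "w \<circ> affine_refl (\<alpha>, 0) \<in> extended_weyl_group R"
proof -
  obtain u b where ub: "w = u \<circ> translation b" "u \<in> weyl_group R" "b \<in> weight_lattice R"
    using w by (auto simp: extended_weyl_group_def)
  let ?b = "b - (b \<bullet> coroot \<alpha>) *\<^sub>R \<alpha>"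
  have "w \<circ> affine_refl (\<alpha>, 0) = (u \<circ> affine_refl (\<alpha>, 0)) \<circ> translation ?b"
    unfolding ub(1) comp_assoc translation_refl[OF \<alpha>] ..
  moreover have "?b \<in> weight_lattice R"
    using ub(3) inner_coroot_Ints \<alpha> by (auto simp: weight_lattice_def inner_diff_left intro!: Ints_diff Ints_mult)
  ultimately show ?thesis using weyl_comp[OF ub(2) \<alpha>] unfolding extended_weyl_group_def by blast
qed

lemma extended_comp_translation:
  assumes w: "w \<in> extended_weyl_group R" and c: "c \<in> weight_lattice R"
  shows "w \<circ> translation c \<in> extended_weyl_group R"
proof -
  obtain u b where ub: "w = u \<circ> translation b" "u \<in> weyl_group R" "b \<in> weight_lattice R"
    using w by (auto simp: extended_weyl_group_def)
  have "w \<circ> translation c = u \<circ> translation (b + c)" unfolding ub(1) comp_assoc translation_add ..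
  moreover have "b + c \<in> weight_lattice R" using ub(3) c by (auto simp: weight_lattice_def inner_add_left)
  ultimately show ?thesis using ub(2) unfolding extended_weyl_group_def by blast
qed

lemma id_extended: "id \<in> extended_weyl_group R"
proof -
  have "id = id \<circ> translation (0 :: 'a)" by (auto simp: translation_def)
  moreover have "id \<in> weyl_group R" "0 \<in> weight_lattice R"
    by (simp_all add: weyl_group_def generated.id weight_lattice_def)
  ultimately show ?thesis unfolding extended_weyl_group_def by blast
qed

text \<open>Reversing the word puts its first letter next to w, so the induction absorbs one
  generator at a time on the right.\<close>

lemma word_extended: "w \<in> extended_weyl_group R \<Longrightarrow> set us \<subseteq> {0..DIM('a)} \<Longrightarrow> w \<circ> word (rev us) \<in> extended_weyl_group R"
proof (induction us arbitrary: w)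
  case Nil
  then show ?case by simp
next
  case (Cons i us)
  then have w: "w \<circ> word (rev us) \<in> extended_weyl_group R" if "w \<in> extended_weyl_group R" for w
    using that by (simp add: comp_def)
  have i: "i \<in> {0..DIM('a)}" using Cons.prems by simp
  have nt: "- \<theta> \<in> weight_lattice R" using inner_coroot_Ints theta_in_R by (auto simp: weight_lattice_def)
  have "w \<circ> srefl i \<in> extended_weyl_group R"
  proof (cases "i = 0")
    case True
    have "w \<circ> srefl 0 = w \<circ> affine_refl (\<theta>, 0) \<circ> translation (- \<theta>)" unfolding srefl_0 comp_assoc ..
    then show ?thesis using True extended_comp_translation[OF extended_comp_refl[OF Cons.prems(1) theta_in_R] nt] by simp
  next
    case False
    then have "i \<in> {1..DIM('a)}" "affine_simple a \<theta> i = (a i, 0)" using i by (auto simp: affine_simple_def)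
    then show ?thesis using extended_comp_refl[OF Cons.prems(1) simple_in_R] by simp
  qed
  from w[OF this] show ?case by (simp add: word_append comp_def)
qed

lemma is_lambda_sequence_if_reduced:
  assumes "reduced us"
  shows "is_lambda_sequence R a \<theta> (lambda_seq a \<theta> us)"
proof -
  have s: "set us \<subseteq> {0..DIM('a)}" using assms by (simp add: reduced_iff)
  have "word us \<in> extended_weyl_group R" using word_extended[OF id_extended, of "rev us"] s by simp
  moreover have "id \<in> Pi_group R a \<theta>" using id_extended by (simp add: Pi_group_def)
  then have "reduced_decomposition R a \<theta> (word us) id us"
    using assms by (simp add: reduced_decomposition_def reduced_def)
  moreover have "set (lambda_seq a \<theta> us) = lambda_set R a (word us)" using reduced_lambda[OF assms] by blast
  ultimately show ?thesis unfolding is_lambda_sequence_def by blast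
qed

lemma abcd_imp_reduced:
  assumes "positive_seq R a xs" "conds_abcd R a xs" "DIM('a) \<ge> 2"
  shows "\<exists>us. reduced us \<and> lambda_seq a \<theta> us = xs"
proof -
  obtain us where us: "set us \<subseteq> {0..DIM('a)}" "lambda_seq a \<theta> us = xs" "lambda_set R a (word us) = set xs"
    using lambda_seq_exists[of xs] assms by (auto simp: positive_seq_def conds_abcd_def)
  then have "reduced us" using assms(1) by (intro reduced_if_lambda) (auto simp: positive_seq_def)
  with us(2) show ?thesis by blast
qed

section \<open>Rank one\<close>

text \<open>The only finite roots are \<open>a 1\<close> and its negative, so the finite part of the
  sum is zero or twice a root.\<close>

lemma rank_one_sum:
  assumes "DIM('a) < 2" "x \<in> Apos" "y \<in> Apos"
  shows "x + y \<notin> Apos"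
proof
  assume s: "x + y \<in> Apos"
  have D: "DIM('a) = 1" using assms(1) DIM_positive[where 'a='a] by linarith
  have c: "\<beta> = a 1 \<or> \<beta> = - a 1" if "\<beta> \<in> R" for \<beta>
  proof -
    have p: "\<beta> = a 1" if "\<beta> \<in> Pos" for \<beta>
    proof -
      have e: "\<beta> = crd 1 \<beta> *\<^sub>R a 1" using Pos_expand(1)[OF that] D by simp
      then have "crd 1 \<beta> *\<^sub>R a 1 \<in> R" using Pos_in_R[OF that] by simp
      then have "crd 1 \<beta> = 1 \<or> crd 1 \<beta> = -1" using scaleR_in_R[OF simple_in_R[of 1]] D by simp
      then have "crd 1 \<beta> = 1" using Pos_expand(2)[OF that, of 1] D by auto
      then show ?thesis using e by simp
    qed
    then show ?thesis using Pos_or_neg[OF that] p[of \<beta>] p[of "- \<beta>"] by (metis minus_minus)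
  qed
  have f: "fst z \<in> R" if "z \<in> Apos" for z using fst_Aroots[OF Apos_in_Aroots[OF that]] .
  have "fst x + fst y \<in> R" using f[OF s] by simp
  moreover have "fst x + fst y = 0 \<or> fst x + fst y = 2 *\<^sub>R fst x"
    using c[OF f[OF assms(2)]] c[OF f[OF assms(3)]] by (auto simp: scaleR_2)
  ultimately show False using zero_notin_R scaleR_in_R[OF f[OF assms(2)], of 2] by auto
qed

text \<open>No equation of the form required in (b) or (d) can occur, and (f) is achieved by sorting
  by level.\<close>

lemma good_orderings_rank_one:
  assumes "DIM('a) < 2" "finite L" "L \<subseteq> Apos"
  shows "good_orderings R a L \<noteq> {}"
proof -
  obtain ys where ys: "set ys = L" "distinct ys" using finite_distinct_list[OF assms(2)] by blast
  define xs where "xs = sort_key snd ys"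
  have xs: "set xs = L" "distinct xs" using ys by (simp_all add: xs_def)
  have AP: "set xs \<subseteq> Apos" using xs assms(3) by simp
  have m: "xs ! p \<in> Apos" if "p < length xs" for p using that AP nth_mem by blast
  have "cond_b xs" "cond_d R a xs" using rank_one_sum[OF assms(1)] m unfolding cond_b_def cond_d_def by metis+
  moreover have "cond_f xs" unfolding cond_f_iff[OF AP]
  proof (intro allI impI)
    fix p q and t :: real assume pq: "p < length xs" "q < length xs" and t: "0 < t" "xs ! p = xs ! q + (0, t)"
    have so: "sorted (map snd xs)" by (simp add: xs_def)
    show "q < p"
    proof (rule ccontr)
      assume "\<not> q < p"
      then have "map snd xs ! p \<le> map snd xs ! q" using pq by (intro sorted_nth_mono[OF so]) auto
      then show False using t pq by simp
    qed
  qed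
  ultimately show ?thesis using xs by (auto simp: good_orderings_def)
qed

section \<open>Orderings of an inversion set and reduced words\<close>

lemma reduced_good_ordering:
  assumes "reduced us" shows "lambda_seq a \<theta> us \<in> good_orderings R a (lambda_set R a (word us))"
  using reduced_conds(1)[OF assms] reduced_lambda[OF assms]
  by (simp add: good_orderings_def conds_abcdef_def conds_abcd_def)

text \<open>The given w serves as the representing element that \<open>lambda_seq_exists\<close>
  asks for in rank one, so the bijection holds in every rank. The word found belongs to w because
  its inversion set determines it.\<close>

lemma bij_good_orderings:
  assumes w: "w \<in> affine_weyl_group a \<theta>" and L: "lambda_set R a w = L"
  shows "bij_betw (lambda_seq a \<theta>) (reduced_words a \<theta> w) (good_orderings R a L)"
  unfolding bij_betw_def
proof
  show "inj_on (lambda_seq a \<theta>) (reduced_words a \<theta> w)"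
    by (rule inj_onI) (auto simp: reduced_words_def intro: lambda_seq_inj)
  show "lambda_seq a \<theta> ` reduced_words a \<theta> w = good_orderings R a L"
  proof
    show "lambda_seq a \<theta> ` reduced_words a \<theta> w \<subseteq> good_orderings R a L"
      using reduced_good_ordering L by (auto simp: reduced_words_iff)
    show "good_orderings R a L \<subseteq> lambda_seq a \<theta> ` reduced_words a \<theta> w"
    proof
      fix xs assume "xs \<in> good_orderings R a L"
      then have xs: "distinct xs" "set xs = L" "cond_b xs" "cond_d R a xs" "cond_f xs" by (auto simp: good_orderings_def)
      obtain js where js: "set js \<subseteq> {0..DIM('a)}" "w = word js" using w by (auto simp: affine_weyl_iff)
      have l: "cond_a R a (set xs)" "cond_c R a (set xs)" "set xs \<subseteq> Apos"
        using lambda_conds(1,2)[OF affine_aut_word[OF js(1)]] js(2) L xs(2) lambda_set_subset by auto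
      obtain us where us: "set us \<subseteq> {0..DIM('a)}" "lambda_seq a \<theta> us = xs" "lambda_set R a (word us) = set xs"
        using lambda_seq_exists[OF xs(1) l(3,1) xs(3) l(2) xs(4)] xs(5,2) js L by blast
      then have r: "reduced us" using xs(1) by (intro reduced_if_lambda) auto
      have "word us = w" using lambda_inj[OF word_in_weyl[OF us(1)] w] us(3) L xs(2) by simp
      then show "xs \<in> lambda_seq a \<theta> ` reduced_words a \<theta> w" using r us(2) reduced_words_iff by blast
    qed
  qed
qed

section \<open>Combinations of roots in the simply-laced case\<close>

lemma equal_norm_coroot:
  assumes "\<alpha> \<in> R" "\<beta> \<in> R" "\<alpha> \<bullet> \<alpha> = \<beta> \<bullet> \<beta>" "\<alpha> \<noteq> \<beta>" "\<alpha> \<noteq> - \<beta>"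
  shows "\<alpha> \<bullet> coroot \<beta> \<in> {-1, 0, 1}"
proof -
  have b: "\<beta> \<bullet> \<beta> > 0" using inner_root_pos[OF assms(2)] .
  have "(\<beta> \<bullet> \<alpha>)\<^sup>2 < (\<beta> \<bullet> \<beta>)\<^sup>2"
    using strict_Cauchy_Schwarz[OF assms(2,1,4,5)] assms(3) by (simp add: power2_eq_square)
  then have "\<bar>\<beta> \<bullet> \<alpha>\<bar> < \<bar>\<beta> \<bullet> \<beta>\<bar>" using abs_le_square_iff[of "\<beta> \<bullet> \<beta>" "\<beta> \<bullet> \<alpha>"] by linarith
  then have "\<bar>\<alpha> \<bullet> \<beta>\<bar> < \<beta> \<bullet> \<beta>" using b by (simp add: inner_commute)
  then have "\<bar>\<alpha> \<bullet> coroot \<beta>\<bar> < 2" using b by (simp add: inner_coroot abs_mult divide_less_eq)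
  moreover obtain m :: int where m: "\<alpha> \<bullet> coroot \<beta> = of_int m" using inner_coroot_Ints[OF assms(2,1)] by (metis Ints_cases)
  ultimately have "\<bar>m\<bar> < 2" by linarith
  then have "m \<in> {-1,0,1}" by auto
  then show ?thesis using m by auto
qed

text \<open>With c the Cartan integer of \<beta> and \<gamma>, and s, t those of the combination
  against them, s = 2u + cv and t = cu + 2v, all three in {-1, 0, 1}. Pairing the combination with
  its own coroot gives us + vt = 2, and among the finitely many cases only u = v = 1
  remains.\<close>

lemma simply_laced_combination:
  fixes u v :: real
  assumes sl: "simply_laced R" and R: "\<beta> \<in> R" "\<gamma> \<in> R" "u *\<^sub>R \<beta> + v *\<^sub>R \<gamma> \<in> R"
    and ne: "\<beta> \<noteq> \<gamma>" "\<beta> \<noteq> - \<gamma>" and uv: "u > 0" "v > 0"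
  shows "u = 1 \<and> v = 1"
proof -
  have indep: False if "x \<in> R" "y \<in> R" "x \<noteq> y" "x \<noteq> - y" "c *\<^sub>R x = d *\<^sub>R y" "d \<noteq> 0" for x y :: 'a and c d :: real
  proof -
    have "y = (c / d) *\<^sub>R x" using arg_cong[OF that(5), of "\<lambda>z. (1 / d) *\<^sub>R z"] that(6) by simp
    then show False using scaleR_in_R[OF that(1), of "c / d"] that(2-4) by auto
  qed
  let ?\<alpha> = "u *\<^sub>R \<beta> + v *\<^sub>R \<gamma>"
  have n: "?\<alpha> \<bullet> ?\<alpha> = \<beta> \<bullet> \<beta>" "\<beta> \<bullet> \<beta> = \<gamma> \<bullet> \<gamma>" "?\<alpha> \<bullet> ?\<alpha> = \<gamma> \<bullet> \<gamma>"
    using sl R unfolding simply_laced_def by blast+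
  have pos: "\<gamma> \<bullet> \<gamma> > 0" using inner_root_pos[OF R(2)] .
  have "?\<alpha> \<noteq> \<beta>" using indep[OF R(1,2) ne, of "1 - u" v] uv by (auto simp: algebra_simps)
  moreover have "?\<alpha> \<noteq> - \<beta>"
  proof
    assume "?\<alpha> = - \<beta>"
    then have "(- 1 - u) *\<^sub>R \<beta> = v *\<^sub>R \<gamma>" by (simp add: algebra_simps)
    then show False using indep[OF R(1,2) ne] uv by auto
  qed
  ultimately have s: "?\<alpha> \<bullet> coroot \<beta> \<in> {-1, 0, 1}" using equal_norm_coroot[OF R(3,1) n(1)] by blast
  have ne': "\<gamma> \<noteq> \<beta>" "\<gamma> \<noteq> - \<beta>" using ne by auto
  have "?\<alpha> \<noteq> \<gamma>" using indep[OF R(2,1) ne', of "1 - v" u] uv by (auto simp: algebra_simps)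
  moreover have "?\<alpha> \<noteq> - \<gamma>"
  proof
    assume "?\<alpha> = - \<gamma>"
    then have "(- 1 - v) *\<^sub>R \<gamma> = u *\<^sub>R \<beta>" by (simp add: algebra_simps add_eq_0_iff)
    then show False using indep[OF R(2,1) ne'] uv by auto
  qed
  ultimately have t: "?\<alpha> \<bullet> coroot \<gamma> \<in> {-1, 0, 1}" using equal_norm_coroot[OF R(3,2) n(3)] by blast
  have c: "\<beta> \<bullet> coroot \<gamma> \<in> {-1, 0, 1}" using equal_norm_coroot[OF R(1,2) n(2) ne] .
  define c s t where "c = \<beta> \<bullet> coroot \<gamma>" and "s = ?\<alpha> \<bullet> coroot \<beta>" and "t = ?\<alpha> \<bullet> coroot \<gamma>"
  have "\<gamma> \<bullet> coroot \<beta> = c" using n(2) by (simp add: c_def inner_coroot inner_commute)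
  moreover have "\<beta> \<bullet> coroot \<beta> = 2" "\<gamma> \<bullet> coroot \<gamma> = 2" using pos n(2) by (simp_all add: inner_coroot)
  ultimately have st: "s = 2 * u + v * c" "t = u * c + 2 * v"
    unfolding s_def t_def by (simp_all add: inner_add_left c_def)
  have "?\<alpha> \<bullet> coroot ?\<alpha> = 2" using inner_root_pos[OF R(3)] by (simp add: inner_coroot)
  \<comment> \<open>All three roots have the same norm, so their coroots are related with the same
    coefficients.\<close>
  moreover have "coroot ?\<alpha> = u *\<^sub>R coroot \<beta> + v *\<^sub>R coroot \<gamma>"
    using n by (simp add: coroot_def scaleR_add_right mult.commute)
  ultimately have e: "u * s + v * t = 2" by (simp add: s_def t_def inner_add_right)
  have "c \<in> {-1,0,1}" "s \<in> {-1,0,1}" "t \<in> {-1,0,1}" using c s t by (simp_all only: c_def s_def t_def)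
  then show ?thesis using st e uv by auto
qed

section \<open>Assembling the assertions\<close>

text \<open>The conditions concern the sequence alone, which is read off from the reduced word; the
  factor from \<Pi> does not enter it.\<close>

lemma conds_if_lambda_sequence: "is_lambda_sequence R a \<theta> xs \<Longrightarrow> conds_abcdef R a xs"
  unfolding is_lambda_sequence_def reduced_decomposition_def reduced_def[symmetric]
  using reduced_conds(1) by blast

lemma lambda_sequence_if_conds:
  assumes "positive_seq R a xs" "conds_abcdef R a xs" "DIM('a) \<ge> 2"
  shows "is_lambda_sequence R a \<theta> xs"
proof -
  have "conds_abcd R a xs" using assms(2) by (simp add: conds_abcdef_def)
  from abcd_imp_reduced[OF assms(1) this assms(3)] show ?thesis
    using is_lambda_sequence_if_reduced by blast
qed

lemma abcd'_if_abcd: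
  assumes "positive_seq R a xs" "conds_abcd R a xs" "DIM('a) \<ge> 2"
  shows "conds_abcd' R a xs"
  using abcd_imp_reduced[OF assms] reduced_conds(2) by blast

lemma abcd_if_abcd':
  assumes "positive_seq R a xs" "conds_abcd' R a xs"
  shows "conds_abcd R a xs"
  using assms rational_conds rational_cond_b[of xs]
  unfolding conds_abcd_def conds_abcd'_def positive_seq_def by blast

lemma unique_lambda_set:
  assumes "finite L" "L \<subseteq> Apos" "cond_a R a L" "cond_c R a L" "DIM('a) \<ge> 2"
  shows "\<exists>!w. w \<in> affine_weyl_group a \<theta> \<and> lambda_set R a w = L"
proof -
  obtain us where "set us \<subseteq> {0..DIM('a)}" "lambda_set R a (word us) = L"
    using lambda_set_exists[OF assms] by blast
  then show ?thesis using word_in_weyl[of us] lambda_inj by (intro ex1I[of _ "word us"]) blast+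
qed

lemma good_orderings_nonempty:
  assumes "finite L" "L \<subseteq> Apos" "cond_a R a L" "cond_c R a L"
  shows "good_orderings R a L \<noteq> {}"
proof (cases "DIM('a) \<ge> 2")
  case True
  then obtain w where w: "w \<in> affine_weyl_group a \<theta>" "lambda_set R a w = L"
    using unique_lambda_set[OF assms] by blast
  then obtain us where "reduced us" "word us = w" using ex_reduced by blast
  then show ?thesis using reduced_good_ordering[of us] w(2) by blast
qed (use good_orderings_rank_one assms in simp)

lemma simply_laced_affine_combination:
  fixes u v :: rat
  assumes sl: "simply_laced R" and xy: "x \<in> Apos" "y \<in> Apos" and uv: "u > 0" "v > 0"
    and ne: "fst x \<noteq> fst y" "fst x \<noteq> - fst y" and s: "of_rat u *\<^sub>R x + of_rat v *\<^sub>R y \<in> Apos"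
  shows "u = 1 \<and> v = 1"
proof -
  have f: "fst z \<in> R" if "z \<in> Apos" for z using fst_Aroots[OF Apos_in_Aroots[OF that]] .
  have c: "of_rat u *\<^sub>R fst x + of_rat v *\<^sub>R fst y \<in> R" using f[OF s] by simp
  have "of_rat u > (0::real)" "of_rat v > (0::real)" using uv by simp_all
  from simply_laced_combination[OF sl f[OF xy(1)] f[OF xy(2)] c ne this] show ?thesis by simp
qed

end

theorem theorem2p1:
  fixes R :: "'a::euclidean_space set" and a :: "nat \<Rightarrow> 'a" and \<theta> :: 'a
  assumes "reduced_root_system R" and "irreducible_roots R" and "normalized_form R"
    and "simple_roots R a" and "maximal_short_root R a \<theta>"
  shows
    "(\<forall>xs. positive_seq R a xs \<longrightarrow>
        (is_lambda_sequence R a \<theta> xs \<longrightarrow> conds_abcdef R a xs) \<and>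
        (DIM('a) \<ge> 2 \<longrightarrow> conds_abcdef R a xs \<longrightarrow> is_lambda_sequence R a \<theta> xs))
     \<and>
     (\<forall>L. finite L \<and> L \<subseteq> affine_pos R a \<and> cond_a R a L \<and> cond_c R a L \<and> cond_e R a L \<longrightarrow>
        good_orderings R a L \<noteq> {} \<and>
        (DIM('a) \<ge> 2 \<longrightarrow> (\<exists>!w. w \<in> affine_weyl_group a \<theta> \<and> lambda_set R a w = L)) \<and>
        (\<forall>w\<in>affine_weyl_group a \<theta>. lambda_set R a w = L \<longrightarrow>
           bij_betw (lambda_seq a \<theta>) (reduced_words a \<theta> w) (good_orderings R a L)))
     \<and>
     (\<forall>xs. positive_seq R a xs \<longrightarrow>
        (DIM('a) \<ge> 2 \<longrightarrow> conds_abcd R a xs \<longrightarrow> conds_abcd' R a xs) \<and>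
        (DIM('a) \<ge> 2 \<longrightarrow> simply_laced R \<longrightarrow> (conds_abcd' R a xs \<longleftrightarrow> conds_abcd R a xs)))
     \<and>
     (simply_laced R \<longrightarrow>
        (\<forall>x\<in>affine_pos R a. \<forall>y\<in>affine_pos R a. \<forall>u v :: rat.
           u > 0 \<and> v > 0 \<and> fst x \<noteq> fst y \<and> fst x \<noteq> - fst y \<and>
           of_rat u *\<^sub>R x + of_rat v *\<^sub>R y \<in> affine_pos R a \<longrightarrow> u = 1 \<and> v = 1))"
proof -
  interpret root_datum R a \<theta> using assms by unfold_locales
  show ?thesis
  proof (intro conjI, goal_cases)
    case 1
    show ?case using conds_if_lambda_sequence lambda_sequence_if_conds by blast
  next
    case 2
    show ?case
    proof (intro allI impI, elim conjE)
      fix L assume L: "finite L" "L \<subseteq> Apos" "cond_a R a L" "cond_c R a L"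
      show "good_orderings R a L \<noteq> {} \<and>
          (DIM('a) \<ge> 2 \<longrightarrow> (\<exists>!w. w \<in> affine_weyl_group a \<theta> \<and> lambda_set R a w = L)) \<and>
          (\<forall>w\<in>affine_weyl_group a \<theta>. lambda_set R a w = L \<longrightarrow>
             bij_betw (lambda_seq a \<theta>) (reduced_words a \<theta> w) (good_orderings R a L))"
        by (intro conjI impI ballI good_orderings_nonempty[OF L] unique_lambda_set[OF L] bij_good_orderings)
    qed
  next
    case 3
    show ?case using abcd'_if_abcd abcd_if_abcd' by blast
  next
    case 4
    show ?case using simply_laced_affine_combination by blast
  qed
qed

end
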